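(* If $k\le p$ and $G\subset\mathbb{F}_q^k$ is an arc of size $2k-2$, then the column space of the matrix $H_G^{\uparrow 0}$ contains the vector $v\in\mathbb{F}_q^{\binom{2k-2}{k-1}}$ with $v_i=1$ for $i\in\{1,\dots,k\}$ and $v_i=0$ otherwise. Hence, if $k\le p$ and $k\ne (q+1)/2$, then the normal rational curve $\mathcal{R}_k$ is the unique arc in $\mathbb{F}_q^k$ of size $q+1$ up to linear equivalence.
   Context: $\mathbb{F}_q$ is a finite field of order $q$ and characteristic $p$. An arc in $\mathbb{F}_q^k$ is an ordered family of at least $k$ vectors in which every subfamily of size $k$ is a basis; subfamilies inherit the order. Two arcs $G,G'$ are linearly equivalent if, for a basis $B$, the matrix whose columns are the vectors of $G$ in coordinates w.r.t. $B$ can be transformed into the corresponding matrix of $G'$ by elementary row operations, column permutations, and multiplying columns by nonzero scalars. The normal rational curve is $\mathcal{R}_k=\{(1,t,\dots,t^{k-1}): t\in\mathbb{F}_q\}\cup\{(0,\dots,0,1)\}$. For an ordered set, a subset $A$ precedes $A'$ in colex order if the largest element of $A\triangle A'$ lies in $A'$. For an arc $G$, $H_G^{\uparrow 0}$ is the $0/1$ matrix with rows indexed by the $(k-1)$-subsets $C$ of $G$ listed in colex order, columns indexed by the $(k-2)$-subsets $A$ of $G$, and $(C,A)$-entry $1$ if $A\subset C$ and $0$ otherwise; the coordinates of $v$ are numbered according to this row order. *)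

theory Defs
  imports
    "Jordan_Normal_Form.VS_Connect"
    "Jordan_Normal_Form.Column_Operations"
    "HOL-Library.Cardinality"
    "HOL-Library.Multiset"
    "HOL-Library.Nat_Bijection"
    "HOL-Combinatorics.Permutations"
begin

text \<open>Vectors of \<open>F^k\<close> are elements of \<^term>\<open>carrier_vec k\<close>; coordinates are numbered from 0.
  Ordered families of vectors are lists, and the subfamily at the set \<open>I\<close> of positions
  is \<^term>\<open>nths G I\<close>. A family with a repeated vector is not a basis.\<close>

definition basis_family :: "nat \<Rightarrow> 'a::field vec list \<Rightarrow> bool" where
  "basis_family k B \<longleftrightarrow>
     distinct B \<and> vectorspace.basis class_ring (module_vec TYPE('a) k) (set B)"

definition arc :: "nat \<Rightarrow> 'a::field vec list \<Rightarrow> bool" where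
  "arc k G \<longleftrightarrow>
     set G \<subseteq> carrier_vec k \<and> k \<le> length G \<and>
     (\<forall>I \<subseteq> {..<length G}. card I = k \<longrightarrow> basis_family k (nths G I))"

definition coords :: "nat \<Rightarrow> 'a::field vec list \<Rightarrow> 'a vec \<Rightarrow> 'a vec" where
  "coords k B x = (THE c. c \<in> carrier_vec k \<and> mat_of_cols k B *\<^sub>v c = x)"

definition coord_matrix :: "nat \<Rightarrow> 'a::field vec list \<Rightarrow> 'a vec list \<Rightarrow> 'a mat" where
  "coord_matrix k B G = mat_of_cols k (map (coords k B) G)"

inductive matrix_step :: "'a::field mat \<Rightarrow> 'a mat \<Rightarrow> bool" where
  swap_rows: "i < dim_row M \<Longrightarrow> j < dim_row M \<Longrightarrow> matrix_step M (swaprows i j M)"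
| scale_row: "i < dim_row M \<Longrightarrow> a \<noteq> 0 \<Longrightarrow> matrix_step M (multrow i a M)"
| add_row: "i < dim_row M \<Longrightarrow> j < dim_row M \<Longrightarrow> i \<noteq> j \<Longrightarrow> matrix_step M (addrow a i j M)"
| permute_cols: "\<pi> permutes {..<dim_col M} \<Longrightarrow>
    matrix_step M (mat (dim_row M) (dim_col M) (\<lambda>(i, j). M $$ (i, \<pi> j)))"
| scale_col: "j < dim_col M \<Longrightarrow> a \<noteq> 0 \<Longrightarrow> matrix_step M (multcol j a M)"

definition linearly_equivalent :: "nat \<Rightarrow> 'a::field vec list \<Rightarrow> 'a vec list \<Rightarrow> bool" where
  "linearly_equivalent k G G' \<longleftrightarrow>
     (\<exists>B. basis_family k B \<and>
        matrix_step\<^sup>*\<^sup>* (coord_matrix k B G) (coord_matrix k B G'))"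

text \<open>The normal rational curve is taken as the (unordered) family of its \<open>q + 1\<close> points; for
  \<open>k \<ge> 2\<close> these are distinct, so that it is a set, as shown below.\<close>

definition normal_rational_curve :: "nat \<Rightarrow> 'a::{field,finite} vec multiset" where
  "normal_rational_curve k =
     image_mset (\<lambda>t. vec k (\<lambda>i. t ^ i)) (mset_set UNIV) + {#unit_vec k (k - 1)#}"

lemma normal_rational_curve_eq_set:
  assumes "k \<ge> 2"
  shows "(normal_rational_curve k :: 'a::{field,finite} vec multiset) =
    mset_set (range (\<lambda>t. vec k (\<lambda>i. t ^ i)) \<union> {unit_vec k (k - 1)})"
proof -
  let ?f = "\<lambda>t::'a. vec k (\<lambda>i. t ^ i)"
  have inj: "inj ?f"
  proof (rule injI)
    fix s t assume "?f s = ?f t"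
    hence "?f s $ 1 = ?f t $ 1" by simp
    thus "s = t" using assms by simp
  qed
  have "unit_vec k (k - 1) \<notin> range ?f"
  proof
    assume "unit_vec k (k - 1) \<in> range ?f"
    then obtain t where "unit_vec k (k - 1) = ?f t" by blast
    hence "unit_vec k (k - 1) $ 0 = ?f t $ 0" by simp
    thus False using assms by simp
  qed
  thus ?thesis
    by (simp add: normal_rational_curve_def image_mset_mset_set[OF inj])
qed

text \<open>Subsets of an ordered family are represented by their sets of positions.\<close>

definition colex_less :: "nat set \<Rightarrow> nat set \<Rightarrow> bool" where
  "colex_less A A' \<longleftrightarrow> A \<noteq> A' \<and> Max (sym_diff A A') \<in> A'"

definition colex_subsets :: "nat \<Rightarrow> nat \<Rightarrow> nat set list" where
  "colex_subsets n r =
     (THE xs. sorted_wrt colex_less xs \<and> set xs = {A. A \<subseteq> {..<n} \<and> card A = r})"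

lemma colex_less_imp_set_encode_less:
  assumes fin: "finite A" "finite B" and less: "colex_less A B"
  shows "set_encode A < set_encode B"
proof -
  define m where "m = Max (sym_diff A B)"
  have ne: "sym_diff A B \<noteq> {}" and mB: "m \<in> B"
    using less by (auto simp: colex_less_def m_def)
  have "m \<in> sym_diff A B" unfolding m_def using fin ne by (intro Max_in) auto
  hence mA: "m \<notin> A" using mB by blast
  have le: "x \<le> m" if "x \<in> sym_diff A B" for x
    unfolding m_def using fin that by (intro Max_ge) auto
  let ?U = "A \<inter> {m<..}"
  have U: "?U = B \<inter> {m<..}" using le by force
  have "A = (A \<inter> {..<m}) \<union> ?U" using mA by (auto, metis linorder_neqE_nat)
  hence "set_encode A = set_encode ((A \<inter> {..<m}) \<union> ?U)" by simp
  also have "\<dots> = set_encode (A \<inter> {..<m}) + set_encode ?U"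
    unfolding set_encode_def using fin by (intro sum.union_disjoint) auto
  also have "set_encode (A \<inter> {..<m}) \<le> set_encode {..<m}"
    unfolding set_encode_def by (intro sum_mono2) auto
  also have "set_encode {..<m} < 2 ^ m"
    unfolding set_encode_def by (simp add: sum_power2 flip: atLeast0LessThan)
  also have "2 ^ m + set_encode ?U = set_encode ({m} \<union> ?U)"
    unfolding set_encode_def using fin by (subst sum.union_disjoint) auto
  also have "\<dots> \<le> set_encode B"
    unfolding set_encode_def U using fin mB by (intro sum_mono2) auto
  finally show ?thesis by simp
qed

lemma colex_less_total:
  assumes "finite A" "finite B" "A \<noteq> B"
  shows "colex_less A B \<or> colex_less B A"
proof -
  have "Max (sym_diff A B) \<in> sym_diff A B" using assms by (intro Max_in) auto
  moreover have "sym_diff A B = sym_diff B A" by blast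
  ultimately show ?thesis using assms(3) unfolding colex_less_def by auto
qed

lemma colex_less_iff_set_encode_less:
  assumes "finite A" "finite B"
  shows "colex_less A B \<longleftrightarrow> set_encode A < set_encode B"
proof
  assume "set_encode A < set_encode B"
  moreover from this have "A \<noteq> B" by auto
  ultimately show "colex_less A B"
    using colex_less_total[OF assms] colex_less_imp_set_encode_less[OF assms(2,1)] by auto
qed (use assms in \<open>rule colex_less_imp_set_encode_less\<close>)

lemma colex_subsets_ex1:
  "\<exists>!xs. sorted_wrt colex_less xs \<and> set xs = {A. A \<subseteq> {..<n} \<and> card A = r}"
proof -
  let ?S = "{A. A \<subseteq> {..<n::nat} \<and> card A = r}"
  have finS: "finite ?S" by (rule finite_subset[of _ "Pow {..<n}"]) auto
  have fin: "finite A" if "A \<in> ?S" for A using that finite_subset by blast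
  have inj: "inj_on set_encode ?S"
    by (rule inj_on_subset[OF inj_on_set_encode]) (use fin in auto)
  have iff: "sorted_wrt colex_less xs \<longleftrightarrow> sorted_wrt (<) (map set_encode xs)"
    if "set xs = ?S" for xs
  proof -
    have "colex_less A B \<longleftrightarrow> set_encode A < set_encode B" if "A \<in> set xs" "B \<in> set xs" for A B
      using fin that \<open>set xs = ?S\<close> by (intro colex_less_iff_set_encode_less) auto
    thus ?thesis
      unfolding sorted_wrt_map by (simp add: sorted_wrt_iff_nth_less)
  qed
  show ?thesis
  proof (rule ex_ex1I)
    let ?ys = "sorted_list_of_set (set_encode ` ?S)"
    let ?xs = "map set_decode ?ys"
    have "set ?xs = set_decode ` set_encode ` ?S" using finS by simp
    also have "\<dots> = (\<lambda>A. A) ` ?S"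
      unfolding image_image using fin by (intro image_cong refl) (simp add: set_encode_inverse)
    finally have set: "set ?xs = ?S" by simp
    have "map set_encode ?xs = ?ys" by (simp add: comp_def set_decode_inverse)
    hence "sorted_wrt colex_less ?xs" using iff[OF set] by simp
    with set show "\<exists>xs. sorted_wrt colex_less xs \<and> set xs = ?S" by blast
  next
    fix xs ys
    assume xs: "sorted_wrt colex_less xs \<and> set xs = ?S"
      and ys: "sorted_wrt colex_less ys \<and> set ys = ?S"
    have "map set_encode xs = map set_encode ys"
      using xs ys iff by (intro strict_sorted_equal) auto
    thus "xs = ys" using inj xs ys by (intro map_inj_on[of set_encode]) simp_all
  qed
qed

definition inclusion_matrix :: "nat \<Rightarrow> 'a::field vec list \<Rightarrow> 'a mat" where
  "inclusion_matrix k G =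
     (let Cs = colex_subsets (length G) (k - 1); As = colex_subsets (length G) (k - 2)
      in mat (length Cs) (length As) (\<lambda>(i, j). if As ! j \<subseteq> Cs ! i then 1 else 0))"

end

theory Submission
  imports Defs "HOL-Computational_Algebra.Polynomial" "Jordan_Normal_Form.DL_Rank"
begin

text \<open>
  Weighting a \<open>(k-2)\<close>-set \<open>A\<close> by a function of \<open>card (A \<inter> K)\<close>, where \<open>K\<close> is a \<open>k\<close>-subset of a
  \<open>(2k-2)\<close>-set, expresses the indicator of the \<open>(k-1)\<close>-subsets of \<open>K\<close> as a combination of columns of
  the inclusion matrix; the weights have denominator \<open>(k-1)!\<close>, which is why \<open>k \<le> p\<close> is needed.

  Let \<open>S\<close> be an arc of size \<open>q + 1\<close> and \<open>G \<subseteq> S\<close> of size \<open>2k - 2\<close>. For a \<open>(k-1)\<close>-subset \<open>C\<close> of \<open>G\<close> let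
  \<open>F(C)\<close> be the product of the determinants \<open>det(C, z)\<close> over \<open>z \<in> S - C\<close> and once more over
  \<open>z \<in> G - C\<close>. Projecting from a \<open>(k-2)\<close>-subset \<open>Y\<close> to a projective line and interpolating there shows
  that \<open>1/F(C)\<close> sums to \<open>0\<close> over the \<open>C\<close> containing \<open>Y\<close>, so by the first part \<open>1/F(C)\<close> sums to \<open>0\<close>
  over \<open>C \<subseteq> K\<close>. In coordinates with \<open>K\<close> as basis this says that, for fixed nonzero \<open>\<beta>\<^sub>i\<close>, the sum of
  \<open>\<beta>\<^sub>i / (\<Prod>z\<in>L. z\<^sub>i)\<close> vanishes for all \<open>(k-2)\<close>-subsets \<open>L\<close> of \<open>S - K\<close>. If \<open>2k \<le> q\<close> there is room to
  vary \<open>L\<close>, and it follows that the coordinatewise inverses of the points of \<open>S - K\<close> lie in a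
  two-dimensional space, which is the Cremona image of a normal rational curve through \<open>K\<close>. If
  \<open>2k \<ge> q + 2\<close>, the dual arc in dimension \<open>q + 1 - k\<close> is covered by this case, and the dual of a normal
  rational curve is again one, because a form of degree \<open>q - 1\<close> sums to \<open>0\<close> over the points of the
  projective line.
\<close>

section \<open>Finite fields and interpolation\<close>

text \<open>The degree bound is on the difference, so that two monic polynomials of degree exactly
  \<open>card A\<close> can be compared, as in \<open>finite_field_prod_nonzero\<close>.\<close>

lemma poly_eqI_card:
  fixes p r :: "'a::idom poly"
  assumes fin: "finite A" and eq: "\<And>x. x \<in> A \<Longrightarrow> poly p x = poly r x"
    and deg: "degree (p - r) < card A"
  shows "p = r"
proof (rule ccontr)
  assume "p \<noteq> r"
  hence "p - r \<noteq> 0" by simp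
  hence "card {x. poly (p - r) x = 0} \<le> degree (p - r)" "finite {x. poly (p - r) x = 0}"
    using card_poly_roots_bound poly_roots_finite by blast+
  moreover have "A \<subseteq> {x. poly (p - r) x = 0}" using eq by auto
  ultimately show False using card_mono[of "{x. poly (p - r) x = 0}" A] deg by linarith
qed

lemma monic_prod_linear:
  fixes A :: "'a::idom set"
  assumes "finite A"
  shows "degree (\<Prod>a\<in>A. [:- a, 1:]) = card A" "coeff (\<Prod>a\<in>A. [:- a, 1:]) (card A) = 1"
proof -
  show deg: "degree (\<Prod>a\<in>A. [:- a, 1:]) = card A"
    by (subst degree_prod_eq_sum_degree) auto
  have "lead_coeff (\<Prod>a\<in>A. [:- a, 1:]) = 1" unfolding lead_coeff_prod by simp
  thus "coeff (\<Prod>a\<in>A. [:- a, 1:]) (card A) = 1" unfolding deg .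
qed

text \<open>Both sides are the coefficient of degree \<open>card A - 1\<close> of the Lagrange
  interpolation polynomial of \<open>p\<close>, whose basis products \<open>l a\<close> are monic of
  that degree.\<close>

lemma sum_interpolation_coeff:
  fixes p :: "'a::field poly"
  assumes fin: "finite A" and deg: "degree p < card A"
  shows "(\<Sum>a\<in>A. poly p a / (\<Prod>b\<in>A - {a}. a - b)) = coeff p (card A - 1)"
proof -
  define l where "l a = (\<Prod>b\<in>A - {a}. [:- b, 1:])" for a
  define c where "c a = poly p a / (\<Prod>b\<in>A - {a}. a - b)" for a
  define r where "r = (\<Sum>a\<in>A. Polynomial.smult (c a) (l a))"
  have dl: "degree (l a) = card A - 1" "coeff (l a) (card A - 1) = 1" if "a \<in> A" for a
    using monic_prod_linear[of "A - {a}"] fin that by (simp_all add: l_def)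
  have val: "poly (l a) x = (\<Prod>b\<in>A - {a}. x - b)" for a x
    unfolding l_def poly_prod by (simp add: algebra_simps)
  have "poly r x = poly p x" if x: "x \<in> A" for x
  proof -
    have "poly r x = (\<Sum>a\<in>A. c a * poly (l a) x)" by (simp add: r_def poly_sum)
    also have "\<dots> = (\<Sum>a\<in>A. if a = x then c x * poly (l x) x else 0)"
    proof (rule sum.cong)
      fix a assume "a \<in> A"
      have "poly (l a) x = 0" if "a \<noteq> x"
        unfolding val using fin x that by (intro prod_zero) auto
      thus "c a * poly (l a) x = (if a = x then c x * poly (l x) x else 0)" by auto
    qed simp
    also have "\<dots> = c x * poly (l x) x" using fin x by simp
    also have "\<dots> = poly p x" using fin by (simp add: c_def val)
    finally show ?thesis .
  qed
  moreover have "degree r \<le> card A - 1" unfolding r_def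
    by (rule degree_sum_le) (use fin dl in \<open>auto intro!: order_trans[OF degree_smult_le]\<close>)
  hence "degree (r - p) < card A" using deg by (intro degree_diff_less) linarith+
  ultimately have "r = p" using fin by (intro poly_eqI_card) auto
  moreover have "coeff r (card A - 1) = (\<Sum>a\<in>A. c a)"
    unfolding r_def coeff_sum using dl by (intro sum.cong) auto
  ultimately show ?thesis by (simp add: c_def)
qed

lemma card_field_ge_2: "CARD('a::{field,finite}) \<ge> 2"
proof -
  have "card {0, 1 :: 'a} \<le> CARD('a)" by (intro card_mono) auto
  thus ?thesis by simp
qed

text \<open>Multiplication by \<open>x\<close> permutes the nonzero elements, so their product
  absorbs the factor \<open>x ^ (q - 1)\<close>.\<close>

lemma finite_field_power_card_minus_1:
  fixes x :: "'a::{field,finite}"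
  assumes "x \<noteq> 0"
  shows "x ^ (CARD('a) - 1) = 1"
proof -
  have "(\<Prod>y\<in>-{0}. y) = (\<Prod>y\<in>-{0}. x * y)"
    by (rule prod.reindex_bij_witness[of _ "\<lambda>y. x * y" "\<lambda>y. y / x"]) (use assms in auto)
  also have "\<dots> = x ^ card (-{0::'a}) * (\<Prod>y\<in>-{0}. y)" by (simp add: prod.distrib)
  finally have "x ^ card (-{0::'a}) = 1" by simp
  thus ?thesis by (simp add: Compl_eq_Diff_UNIV)
qed

text \<open>In a product of \<open>q + 1\<close> factors a common scalar is felt only through its
  square. In particular a common sign disappears, for odd and even \<open>q\<close> alike.\<close>

lemma finite_field_power_card_plus_1:
  fixes x :: "'a::{field,finite}"
  shows "x ^ (CARD('a) + 1) = x\<^sup>2"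
proof (cases "x = 0")
  case False
  have "CARD('a) + 1 = (CARD('a) - 1) + 2" using card_field_ge_2[where 'a='a] by simp
  thus ?thesis using finite_field_power_card_minus_1[OF False] by (simp only: power_add) simp
qed simp

text \<open>Wilson's theorem for finite fields: evaluate at 0 the factorisation of
  \<open>X ^ (q - 1) - 1\<close> into the factors \<open>X - a\<close> with \<open>a\<close>
  nonzero.\<close>

lemma finite_field_prod_nonzero: "(\<Prod>x\<in>-{0::'a::{field,finite}}. x) = -1"
proof -
  let ?n = "CARD('a) - 1"
  have n: "card (-{0::'a}) = ?n" by (simp add: Compl_eq_Diff_UNIV)
  have pos: "?n > 0" using card_field_ge_2[where 'a='a] by simp
  let ?p = "\<Prod>a\<in>-{0::'a}. [:- a, 1:]" and ?r = "monom 1 ?n - 1 :: 'a poly"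
  have dp: "degree ?p = ?n" "coeff ?p ?n = 1" using monic_prod_linear[of "-{0::'a}"] n by auto
  have "degree (?p - ?r) < card (-{0::'a})" unfolding n
  proof (rule degree_lessI)
    show "\<forall>m\<ge>?n. coeff (?p - ?r) m = 0"
    proof (intro allI impI)
      fix m assume m: "m \<ge> ?n"
      show "coeff (?p - ?r) m = 0"
      proof (cases "m = ?n")
        case True thus ?thesis using dp(2) pos by simp
      next
        case False
        hence "m > ?n" using m by simp
        hence "coeff ?p m = 0" "coeff ?r m = 0"
          using dp(1) by (simp_all add: coeff_eq_0)
        thus ?thesis by simp
      qed
    qed
  qed (use pos in auto)
  moreover have "poly ?p x = poly ?r x" if "x \<in> -{0}" for x
  proof -
    have "poly ?p x = 0" unfolding poly_prod using that by (intro prod_zero bexI[of _ x]) auto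
    thus ?thesis using finite_field_power_card_minus_1[of x] that by (simp add: poly_monom)
  qed
  ultimately have "?p = ?r" by (intro poly_eqI_card[of "-{0::'a}"]) auto
  hence "poly ?p 0 = poly ?r 0" by simp
  hence "(\<Prod>x\<in>-{0::'a}. - x) = -1" using pos by (simp add: poly_prod poly_monom)
  \<comment> \<open>Negation permutes the nonzero elements, so no sign \<open>(-1) ^ (q - 1)\<close>
    has to be evaluated.\<close>
  moreover have "(\<Prod>x\<in>-{0::'a}. - x) = (\<Prod>x\<in>-{0::'a}. x)"
    by (rule prod.reindex_bij_witness[of _ uminus uminus]) auto
  ultimately show ?thesis by simp
qed

lemma finite_field_prod_diff: "(\<Prod>x\<in>-{a::'a::{field,finite}}. a - x) = -1"
proof -
  have "(\<Prod>x\<in>-{a}. a - x) = (\<Prod>x\<in>-{0::'a}. x)"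
    by (rule prod.reindex_bij_witness[of _ "\<lambda>x. a - x" "\<lambda>x. a - x"]) auto
  thus ?thesis by (simp add: finite_field_prod_nonzero)
qed

text \<open>Interpolation of a monomial at all elements of the field: every Lagrange denominator
  equals -1, so the sum is minus the coefficient in degree \<open>q - 1\<close>.\<close>

lemma finite_field_sum_power:
  assumes "m \<le> CARD('a) - 1"
  shows "(\<Sum>x\<in>(UNIV::'a::{field,finite} set). x ^ m) = (if m = CARD('a) - 1 then -1 else 0)"
proof -
  have "(\<Sum>x\<in>(UNIV::'a set). poly (monom 1 m) x / (\<Prod>b\<in>UNIV - {x}. x - b)) = coeff (monom (1::'a) m) (CARD('a) - 1)"
    using assms card_field_ge_2[where 'a='a]
    by (intro sum_interpolation_coeff) (auto simp: degree_monom_eq)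
  hence "- (\<Sum>x\<in>(UNIV::'a set). x ^ m) = (if m = CARD('a) - 1 then 1 else 0)"
    by (simp add: poly_monom finite_field_prod_diff sum_negf flip: Compl_eq_Diff_UNIV)
  thus ?thesis by (auto simp: minus_equation_iff)
qed

section \<open>A vanishing sum on the projective line\<close>

text \<open>The terms of the sum are the values of a form of degree \<open>card E - 2\<close>, namely the product
  of the linear forms at the points of the projective line outside \<open>I\<close>, divided by the usual
  Lagrange denominators; \<open>y\<close> plays the role of the point at infinity.\<close>

lemma projective_line_sum_zero:
  fixes f h :: "'b \<Rightarrow> 'a::{field,finite}"
  assumes D: "\<And>z a. z \<in> I \<Longrightarrow> a \<in> I \<Longrightarrow> D z a = d * (f z * h a - h z * f a)"
    and fin: "finite I" and EI: "E \<subseteq> I" and card: "card I + card E = CARD('a) + 3"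
    and E2: "card E \<ge> 2"
    and nz: "\<And>z a. z \<in> I \<Longrightarrow> a \<in> I \<Longrightarrow> z \<noteq> a \<Longrightarrow> D z a \<noteq> 0"
    and y: "y \<in> E" "f y = 0"
  shows "(\<Sum>a\<in>E. 1 / ((\<Prod>z\<in>I - {a}. D z a) * (\<Prod>z\<in>E - {a}. D z a))) = 0"
proof -
  define I' where "I' = I - {y}"
  define E' where "E' = E - {y}"
  \<comment> \<open>Within \<open>I\<close>, \<open>f\<close> vanishes only at \<open>y\<close>, so
    \<open>l\<close> is an affine coordinate on the other points.\<close>
  define l where "l z = h z / f z" for z
  have finE: "finite E" using fin EI finite_subset by blast
  have yI: "y \<in> I" using y EI by blast
  have fin': "finite I'" "finite E'" using fin finE by (auto simp: I'_def E'_def)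
  have E'I': "E' \<subseteq> I'" using EI by (auto simp: I'_def E'_def)
  have cI': "card I' = card I - 1" and cE': "card E' = card E - 1"
    using yI y by (auto simp: I'_def E'_def)
  have "card I \<ge> card E" using EI fin by (rule card_mono[rotated])
  hence cIE: "card I' + card E' = CARD('a) + 1" and cE1: "card E' \<ge> 1"
    using card E2 cI' cE' by linarith+
  have E'ne: "E' \<noteq> {}" using cE1 by auto
  have fnz: "f z \<noteq> 0" if "z \<in> I'" for z
    using nz[of z y] D[of z y] yI that y by (auto simp: I'_def)
  obtain e where e: "e \<in> E'" using E'ne by blast
  hence eI: "e \<in> I" "e \<noteq> y" using E'I' by (auto simp: I'_def)
  have dnz: "d \<noteq> 0" "h y \<noteq> 0" using nz[of e y] D[of e y] eI yI y by auto
  have D': "D z a = d * f z * f a * (l a - l z)" if "z \<in> I'" "a \<in> I'" for z a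
  proof -
    have "f z * f a * (l a - l z) = f z * h a - h z * f a"
      using fnz[OF that(1)] fnz[OF that(2)] by (simp add: l_def field_simps)
    thus ?thesis using D[of z a] that by (simp add: I'_def mult.assoc)
  qed
  have Dy: "D y a = - (d * h y * f a)" "D a y = d * h y * f a" if "a \<in> I'" for a
    using D[of y a] D[of a y] that y yI by (auto simp: I'_def)
  have inj: "inj_on l I'"
  proof (rule inj_onI, rule ccontr)
    fix a b assume ab: "a \<in> I'" "b \<in> I'" "l a = l b" "a \<noteq> b"
    hence "D a b = 0" using D' by simp
    thus False using nz[of a b] ab by (auto simp: I'_def)
  qed
  define P where "P = (\<Prod>z\<in>I'. f z) * (\<Prod>z\<in>E'. f z)"
  \<comment> \<open>The part of every denominator that is independent of \<open>a\<close>. The total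
    exponent \<open>card I' + card E' = q + 1\<close> of \<open>d\<close>, \<open>h y\<close> and
    \<open>f a\<close> collapses to 2, and the square of \<open>f a\<close> then cancels against the
    division of \<open>P\<close> by it.\<close>
  define \<kappa> where "\<kappa> = d ^ 2 * h y ^ 2 * P"
  have \<kappa>: "\<kappa> \<noteq> 0" using dnz fnz fin' E'I' by (auto simp: \<kappa>_def P_def)
  define \<Lambda> where "\<Lambda> = l ` I'"
  \<comment> \<open>The roots of \<open>p\<close> are the affine points of the line outside the
    image of \<open>I'\<close>.\<close>
  define p where "p = (\<Prod>x\<in>-\<Lambda>. [:- x, 1:])"
  have p: "degree p = CARD('a) - card I'" "coeff p (CARD('a) - card I') = 1"
    using monic_prod_linear[of "-\<Lambda>"] inj
    by (simp_all add: p_def \<Lambda>_def Compl_eq_Diff_UNIV card_Diff_subset card_image)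
  \<comment> \<open>Used for both \<open>I\<close> and \<open>E\<close>: the factor at
    \<open>y\<close> is split off and the others are written in the coordinate
    \<open>l\<close>.\<close>
  have prod_one: "(\<Prod>z\<in>X - {a}. D z a) =
      d ^ card X' * h y * (f a) ^ card X' * ((\<Prod>z\<in>X'. f z) / f a) * - (\<Prod>z\<in>X' - {a}. l a - l z)"
    if X: "X' = X - {y}" "y \<in> X" "X' \<subseteq> I'" "a \<in> X'" for X X' a
  proof -
    have fX: "finite X'" using X fin' finite_subset by blast
    have aI: "a \<in> I'" using X by blast
    have "X - {a} = insert y (X' - {a})" using X by auto
    hence "(\<Prod>z\<in>X - {a}. D z a) = D y a * (\<Prod>z\<in>X' - {a}. D z a)"
      using fX X by simp
    also have "(\<Prod>z\<in>X' - {a}. D z a) = (\<Prod>z\<in>X' - {a}. (d * f a) * f z * (l a - l z))"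
      using X aI by (intro prod.cong) (auto simp: D')
    also have "\<dots> = (d * f a) ^ (card X' - 1) * (\<Prod>z\<in>X' - {a}. f z) * (\<Prod>z\<in>X' - {a}. l a - l z)"
      using X fX by (simp add: prod.distrib)
    also have "(\<Prod>z\<in>X' - {a}. f z) = (\<Prod>z\<in>X'. f z) / f a"
      using fX X fnz[OF aI] by (simp add: prod_diff1)
    also have "D y a = - ((d * f a) * h y)" using Dy(1)[OF aI] by simp
    also have "- ((d * f a) * h y) * ((d * f a) ^ (card X' - 1) * ((\<Prod>z\<in>X'. f z) / f a) * (\<Prod>z\<in>X' - {a}. l a - l z))
      = (d * f a) ^ Suc (card X' - 1) * h y * ((\<Prod>z\<in>X'. f z) / f a) * - (\<Prod>z\<in>X' - {a}. l a - l z)"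
      by simp
    also have "Suc (card X' - 1) = card X'" using X fX by (metis Suc_pred' card_gt_0_iff empty_iff)
    finally show ?thesis by (simp add: power_mult_distrib mult_ac)
  qed
  have term_eq: "1 / ((\<Prod>z\<in>I - {a}. D z a) * (\<Prod>z\<in>E - {a}. D z a)) =
      - (poly p (l a) / (\<Prod>z\<in>E' - {a}. l a - l z)) / \<kappa>" if a: "a \<in> E'" for a
  proof -
    have aI: "a \<in> I'" using a E'I' by blast
    \<comment> \<open>The product of \<open>l a - x\<close> over all \<open>x\<close> other than
      \<open>l a\<close> is -1. Splitting it into points inside and outside \<open>\<Lambda>\<close>
      turns the reciprocal of the product over \<open>I'\<close> into minus a value of
      \<open>p\<close>.\<close>
    have "(\<Prod>x\<in>-{l a}. l a - x) = (\<Prod>x\<in>(\<Lambda> - {l a}) \<union> -\<Lambda>. l a - x)"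
      using aI by (intro prod.cong) (auto simp: \<Lambda>_def)
    also have "\<dots> = (\<Prod>x\<in>\<Lambda> - {l a}. l a - x) * (\<Prod>x\<in>-\<Lambda>. l a - x)"
      by (intro prod.union_disjoint) auto
    also have "(\<Prod>x\<in>-\<Lambda>. l a - x) = poly p (l a)" by (simp add: p_def poly_prod)
    also have "\<Lambda> - {l a} = l ` (I' - {a})"
      unfolding \<Lambda>_def using inj aI by (subst inj_on_image_set_diff[of l I']) auto
    also have "(\<Prod>x\<in>l ` (I' - {a}). l a - x) = (\<Prod>z\<in>I' - {a}. l a - l z)"
      by (subst prod.reindex) (use inj in \<open>auto intro: inj_on_subset\<close>)
    finally have w: "(\<Prod>z\<in>I' - {a}. l a - l z) * poly p (l a) = -1"
      by (simp add: finite_field_prod_diff)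
    hence pnz: "(\<Prod>z\<in>I' - {a}. l a - l z) \<noteq> 0" by auto
    have ip: "1 / (\<Prod>z\<in>I' - {a}. l a - l z) = - poly p (l a)"
      using w pnz by (simp add: field_simps)
    define u where "u = (\<Prod>z\<in>I' - {a}. l a - l z)"
    define v where "v = (\<Prod>z\<in>E' - {a}. l a - l z)"
    have "(\<Prod>z\<in>I - {a}. D z a) * (\<Prod>z\<in>E - {a}. D z a) =
      d ^ (card I' + card E') * h y ^ 2 * f a ^ (card I' + card E') * (P / f a ^ 2) * (u * v)"
      unfolding prod_one[OF I'_def yI subset_refl aI] prod_one[OF E'_def y(1) E'I' a]
      by (simp add: P_def u_def v_def power_add power2_eq_square)
    also have "\<dots> = \<kappa> * (u * v)"
      unfolding cIE finite_field_power_card_plus_1 using fnz[OF aI] by (simp add: \<kappa>_def)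
    finally have "1 / ((\<Prod>z\<in>I - {a}. D z a) * (\<Prod>z\<in>E - {a}. D z a)) = (1 / u) / v / \<kappa>" by simp
    thus ?thesis unfolding u_def ip by (simp add: v_def)
  qed
  have "(\<Prod>z\<in>X'. D z y) = d ^ card X' * h y ^ card X' * (\<Prod>z\<in>X'. f z)" if "X' \<subseteq> I'" for X'
  proof -
    have "(\<Prod>z\<in>X'. D z y) = (\<Prod>z\<in>X'. d * h y * f z)" using that by (intro prod.cong) (auto simp: Dy)
    thus ?thesis by (simp add: prod.distrib power_mult_distrib)
  qed
  hence "(\<Prod>z\<in>I - {y}. D z y) * (\<Prod>z\<in>E - {y}. D z y) =
      d ^ (card I' + card E') * h y ^ (card I' + card E') * P"
    unfolding I'_def[symmetric] E'_def[symmetric] using E'I' by (simp add: P_def power_add)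
  also have "\<dots> = \<kappa>" unfolding cIE finite_field_power_card_plus_1 by (simp add: \<kappa>_def)
  finally have termy: "1 / ((\<Prod>z\<in>I - {y}. D z y) * (\<Prod>z\<in>E - {y}. D z y)) = 1 / \<kappa>" by simp
  have injE: "inj_on l E'" using inj E'I' by (rule inj_on_subset)
  have "(\<Sum>a\<in>E'. poly p (l a) / (\<Prod>z\<in>E' - {a}. l a - l z)) =
      (\<Sum>x\<in>l ` E'. poly p x / (\<Prod>b\<in>l ` E' - {x}. x - b))"
  proof (subst sum.reindex[OF injE], rule sum.cong[OF refl])
    fix a assume a: "a \<in> E'"
    have "l ` E' - {l a} = l ` (E' - {a})" using injE a by (subst inj_on_image_set_diff[of l E']) auto
    moreover have "(\<Prod>x\<in>l ` (E' - {a}). l a - x) = (\<Prod>z\<in>E' - {a}. l a - l z)"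
      by (subst prod.reindex) (use injE in \<open>auto intro: inj_on_subset\<close>)
    ultimately show "poly p (l a) / (\<Prod>z\<in>E' - {a}. l a - l z) =
        ((\<lambda>x. poly p x / (\<Prod>b\<in>l ` E' - {x}. x - b)) \<circ> l) a" by simp
  qed
  \<comment> \<open>\<open>p\<close> is monic of degree \<open>q - card I' = card E' - 1\<close>,
    exactly the degree whose coefficient interpolation at \<open>E'\<close> extracts. So this sum is
    1, and the terms at the affine points cancel the term \<open>1 / \<kappa>\<close> at
    \<open>y\<close>.\<close>
  also have "\<dots> = coeff p (card (l ` E') - 1)"
    using p cIE cE1 injE fin' by (intro sum_interpolation_coeff) (auto simp: card_image)
  also have "card (l ` E') - 1 = CARD('a) - card I'" using cIE injE by (simp add: card_image)
  finally have main: "(\<Sum>a\<in>E'. poly p (l a) / (\<Prod>z\<in>E' - {a}. l a - l z)) = 1" using p by simp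
  have "(\<Sum>a\<in>E. 1 / ((\<Prod>z\<in>I - {a}. D z a) * (\<Prod>z\<in>E - {a}. D z a))) =
    1 / \<kappa> + (\<Sum>a\<in>E'. 1 / ((\<Prod>z\<in>I - {a}. D z a) * (\<Prod>z\<in>E - {a}. D z a)))"
    using finE y termy by (simp add: sum.remove[of E y] E'_def)
  also have "\<dots> = 1 / \<kappa> - (\<Sum>a\<in>E'. poly p (l a) / (\<Prod>z\<in>E' - {a}. l a - l z)) / \<kappa>"
    using term_eq by (simp add: sum_negf sum_divide_distrib)
  also have "\<dots> = 0" by (simp add: main)
  finally show ?thesis .
qed

section \<open>Elementary row operations and linear equivalence\<close>

text \<open>Both sides say that the matrix has rank \<open>k\<close>; repeated columns would already
  lower the rank.\<close>

lemma basis_family_iff_det: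
  fixes B :: "'a::field vec list"
  assumes B: "set B \<subseteq> carrier_vec k" "length B = k"
  shows "basis_family k B \<longleftrightarrow> det (mat_of_cols k B) \<noteq> 0"
proof -
  interpret vec_space "TYPE('a)" k .
  let ?A = "mat_of_cols k B"
  have A: "?A \<in> carrier_mat k k" using B by (metis mat_of_cols_carrier(1))
  have cols: "cols ?A = B" using B by simp
  show ?thesis
  proof
    assume "basis_family k B"
    hence "distinct B" "lin_indpt (set B)" by (auto simp: basis_family_def basis_def)
    hence "rank ?A = k" using lin_indpt_full_rank[OF A] cols by simp
    thus "det ?A \<noteq> 0" using det_rank_iff[OF A] by simp
  next
    assume d: "det ?A \<noteq> 0"
    hence r: "rank ?A = k" using det_rank_iff[OF A] by simp
    have dist: "distinct B" using non_distinct_low_rank[OF A] r cols by auto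
    hence li: "lin_indpt (set B)" using full_rank_lin_indpt[OF A r] cols by simp
    have "basis (set B)"
      by (rule dim_li_is_basis[OF fin_dim _ _ li]) (use B dist in \<open>auto simp: dim_is_n distinct_card\<close>)
    thus "basis_family k B" using dist by (simp add: basis_family_def)
  qed
qed

text \<open>Quantifying over all widths \<open>n\<close> and all \<open>M\<close> makes the property
  closed under products, so that a factorisation into elementary matrices can be applied to the
  coordinate matrix of an arc.\<close>

definition row_operation :: "nat \<Rightarrow> 'a::field mat \<Rightarrow> bool" where
  "row_operation k E \<longleftrightarrow> E \<in> carrier_mat k k \<and> det E \<noteq> 0 \<and>
     (\<forall>n. \<forall>M \<in> carrier_mat k n. matrix_step\<^sup>*\<^sup>* M (E * M))"

lemma row_operation_mult:
  assumes "row_operation k E" "row_operation k F"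
  shows "row_operation k (E * F)"
proof -
  have EF: "E \<in> carrier_mat k k" "F \<in> carrier_mat k k" using assms by (auto simp: row_operation_def)
  have "matrix_step\<^sup>*\<^sup>* M (E * F * M)" if M: "M \<in> carrier_mat k n" for M n
  proof -
    have "matrix_step\<^sup>*\<^sup>* M (F * M)" using assms(2) M by (auto simp: row_operation_def)
    also have "matrix_step\<^sup>*\<^sup>* (F * M) (E * (F * M))"
      using assms(1) mult_carrier_mat[OF EF(2) M] unfolding row_operation_def by blast
    also have "E * (F * M) = E * F * M" using M EF by simp
    finally show ?thesis .
  qed
  thus ?thesis using assms EF by (auto simp: row_operation_def det_mult)
qed

lemma row_operation_one: "row_operation k (1\<^sub>m k)"
  by (auto simp: row_operation_def)

lemma row_operation_swap:
  assumes "i < k" "j < k"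
  shows "row_operation k (swaprows_mat k i j :: 'a::field mat)"
proof -
  have "matrix_step\<^sup>*\<^sup>* M (swaprows_mat k i j * M)" if M: "M \<in> carrier_mat k n" for M :: "'a mat" and n
    using swaprows_mat[OF M assms] matrix_step.swap_rows[of i M j] assms M by auto
  moreover have "det (swaprows_mat k i j) \<noteq> (0::'a)"
  \<comment> \<open>In \<open>row_reduction\<close> the pivot may already sit in its row, so a swap
    of a row with itself must be allowed; its matrix is the identity.\<close>
  proof (cases "i = j")
    case True
    hence "swaprows_mat k i j = (1\<^sub>m k :: 'a mat)" by (intro eq_matI) auto
    thus ?thesis by simp
  qed (use assms in \<open>simp add: det_swaprows_mat\<close>)
  ultimately show ?thesis by (auto simp: row_operation_def)
qed

lemma row_operation_scale:
  assumes "i < k" "a \<noteq> 0"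
  shows "row_operation k (multrow_mat k i a)"
proof -
  have "matrix_step\<^sup>*\<^sup>* M (multrow_mat k i a * M)" if M: "M \<in> carrier_mat k n" for M n
    using multrow_mat[OF M] matrix_step.scale_row[of i M a] assms M by auto
  thus ?thesis using assms by (auto simp: row_operation_def det_multrow_mat)
qed

lemma row_operation_add:
  assumes "i < k" "j < k" "i \<noteq> j"
  shows "row_operation k (addrow_mat k a i j)"
proof -
  have "matrix_step\<^sup>*\<^sup>* M (addrow_mat k a i j * M)" if M: "M \<in> carrier_mat k n" for M n
    using addrow_mat[OF M] matrix_step.add_row[of i M j a] assms M by auto
  thus ?thesis using assms by (auto simp: row_operation_def det_addrow_mat)
qed

section \<open>Gauss-Jordan elimination by elementary row operations\<close>

lemma mult_vec_index:
  assumes "A \<in> carrier_mat n m" "v \<in> carrier_vec m" "i < n"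
  shows "(A *\<^sub>v v) $ i = (\<Sum>j<m. A $$ (i, j) * v $ j)"
  using assms by (auto simp: scalar_prod_def atLeast0LessThan intro!: sum.cong)

text \<open>Otherwise column \<open>j\<close> would be a combination of the first \<open>j\<close>
  columns, which are unit vectors, and the vector \<open>v\<close> of coefficients would lie in the
  kernel of \<open>B\<close>.\<close>

lemma pivot_exists:
  fixes B :: "'a::field mat"
  assumes B: "B \<in> carrier_mat k k" "det B \<noteq> 0" and j: "j < k"
    and unit: "\<And>i c. i < k \<Longrightarrow> c < j \<Longrightarrow> B $$ (i, c) = (if i = c then 1 else 0)"
  shows "\<exists>i. j \<le> i \<and> i < k \<and> B $$ (i, j) \<noteq> 0"
proof (rule ccontr)
  assume no: "\<not> ?thesis"
  define v where "v = vec k (\<lambda>c. if c = j then 1 else if c < j then - B $$ (c, j) else 0)"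
  have v: "v \<in> carrier_vec k" by (simp add: v_def)
  have "v $ j \<noteq> 0\<^sub>v k $ j" using j by (simp add: v_def)
  hence "v \<noteq> 0\<^sub>v k" by metis
  moreover have "B *\<^sub>v v = 0\<^sub>v k"
  proof (rule eq_vecI)
    fix i assume "i < dim_vec (0\<^sub>v k)"
    hence i: "i < k" by simp
    have "(B *\<^sub>v v) $ i = (\<Sum>c<k. B $$ (i, c) * v $ c)" by (rule mult_vec_index[OF B(1) v i])
    also have "\<dots> = (\<Sum>c<k. (if c = j then B $$ (i, j) else 0) + (if c = i then (if i < j then - B $$ (i, j) else 0) else 0))"
      using unit[OF i] by (intro sum.cong) (auto simp: v_def)
    also have "\<dots> = 0" using i j no by (auto simp: sum.distrib)
    finally show "(B *\<^sub>v v) $ i = 0\<^sub>v k $ i" using i by simp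
  qed (use B in auto)
  ultimately show False using det_0_iff_vec_prod_zero_field[OF B(1)] B(2) v by auto
qed

text \<open>Induction on the number \<open>r\<close> of rows already treated. Adding multiples of
  row \<open>j\<close> leaves the earlier columns intact because row \<open>j\<close> is zero
  there.\<close>

lemma eliminate_column:
  fixes B :: "'a::field mat"
  assumes B: "B \<in> carrier_mat k k" and j: "j < k" and pivot: "B $$ (j, j) = 1"
    and unit: "\<And>i c. i < k \<Longrightarrow> c < j \<Longrightarrow> B $$ (i, c) = (if i = c then 1 else 0)"
  shows "r \<le> k \<Longrightarrow> \<exists>E. row_operation k E \<and> (E * B) $$ (j, j) = 1 \<and>
    (\<forall>i<k. \<forall>c<j. (E * B) $$ (i, c) = (if i = c then 1 else 0)) \<and>
    (\<forall>i<r. i \<noteq> j \<longrightarrow> (E * B) $$ (i, j) = 0)"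
proof (induction r)
  case 0
  show ?case using B pivot unit by (intro exI[of _ "1\<^sub>m k"]) (auto simp: row_operation_one)
next
  case (Suc r)
  then obtain E where E: "row_operation k E" "(E * B) $$ (j, j) = 1"
    "\<And>i c. i < k \<Longrightarrow> c < j \<Longrightarrow> (E * B) $$ (i, c) = (if i = c then 1 else 0)"
    "\<And>i. i < r \<Longrightarrow> i \<noteq> j \<Longrightarrow> (E * B) $$ (i, j) = 0" by auto
  have Ec: "E \<in> carrier_mat k k" using E by (simp add: row_operation_def)
  have EB: "E * B \<in> carrier_mat k k" using Ec B by simp
  show ?case
  proof (cases "r = j")
    case True
    thus ?thesis using E by (intro exI[of _ E]) (auto simp: less_Suc_eq)
  next
    case False
    let ?a = "- (E * B) $$ (r, j)"
    let ?F = "addrow_mat k ?a r j"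
    have "?F * E * B = ?F * (E * B)" using Ec B by (intro assoc_mult_mat) auto
    also have "\<dots> = addrow ?a r j (E * B)" using addrow_mat[OF EB j, of ?a r] by simp
    finally have eq: "?F * E * B = addrow ?a r j (E * B)" .
    have idx: "(?F * E * B) $$ (i, c) = (if r = i then ?a * (E * B) $$ (j, c) + (E * B) $$ (i, c) else (E * B) $$ (i, c))"
      if "i < k" "c < k" for i c
      unfolding eq using that EB by (subst index_mat_addrow) auto
    have "row_operation k (?F * E)"
      using Suc.prems j False E(1) by (intro row_operation_mult row_operation_add) auto
    moreover have "(?F * E * B) $$ (j, j) = 1" using idx[OF j j] E(2) False by simp
    moreover have "(?F * E * B) $$ (i, c) = (if i = c then 1 else 0)" if "i < k" "c < j" for i c
      using idx[of i c] E(3) that j by auto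
    moreover have "(?F * E * B) $$ (i, j) = 0" if "i < Suc r" "i \<noteq> j" for i
      using idx[of i j] E(2,4) that j Suc.prems False by (auto simp: less_Suc_eq)
    ultimately show ?thesis by blast
  qed
qed

lemma row_reduction:
  fixes B :: "'a::field mat"
  assumes B: "B \<in> carrier_mat k k" "det B \<noteq> 0"
  shows "j \<le> k \<Longrightarrow> \<exists>E. row_operation k E \<and>
    (\<forall>i<k. \<forall>c<j. (E * B) $$ (i, c) = (if i = c then 1 else 0))"
proof (induction j)
  case 0
  show ?case using row_operation_one by auto
next
  case (Suc j)
  hence j: "j < k" by simp
  from Suc obtain E where E: "row_operation k E"
    "\<And>i c. i < k \<Longrightarrow> c < j \<Longrightarrow> (E * B) $$ (i, c) = (if i = c then 1 else 0)" by auto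
  have Ec: "E \<in> carrier_mat k k" "det E \<noteq> 0" using E by (auto simp: row_operation_def)
  let ?B = "E * B"
  have EB: "?B \<in> carrier_mat k k" "det ?B \<noteq> 0" using Ec B by (auto simp: det_mult)
  obtain p where p: "j \<le> p" "p < k" "?B $$ (p, j) \<noteq> 0" using pivot_exists[OF EB j E(2)] by blast
  let ?S = "swaprows_mat k p j" and ?T = "multrow_mat k j (1 / ?B $$ (p, j))"
  have S: "?S \<in> carrier_mat k k" and T: "?T \<in> carrier_mat k k" by auto
  have ro: "row_operation k (?T * ?S * E)"
    using p j E by (intro row_operation_mult row_operation_scale row_operation_swap) auto
  let ?C = "?T * ?S * E * B"
  have "?C = ?T * ?S * ?B" by (rule assoc_mult_mat[of _ k k _ k _ k]) (use Ec B S T in auto)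
  also have "\<dots> = ?T * (?S * ?B)" by (rule assoc_mult_mat[of _ k k _ k _ k]) (use Ec B S T in auto)
  also have "?S * ?B = swaprows p j ?B" using swaprows_mat[OF EB(1) p(2) j] by simp
  also have "?T * swaprows p j ?B = multrow j (1 / ?B $$ (p, j)) (swaprows p j ?B)"
    by (rule multrow_mat[symmetric, of _ k k]) (use EB in auto)
  finally have C: "?C = multrow j (1 / ?B $$ (p, j)) (swaprows p j ?B)" .
  have Cc: "?C \<in> carrier_mat k k" unfolding C using EB by simp
  have idx: "?C $$ (i, c) = (if i = j then ?B $$ (p, c) / ?B $$ (p, j) else if i = p then ?B $$ (j, c) else ?B $$ (i, c))"
    if "i < k" "c < k" for i c
    unfolding C using that p j carrier_matD[OF Ec(1)] carrier_matD[OF B(1)] by auto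
  have "?C $$ (j, j) = 1" using idx[OF j j] p by simp
  moreover have "?C $$ (i, c) = (if i = c then 1 else 0)" if "i < k" "c < j" for i c
    using idx[of i c] that j p E(2) by auto
  ultimately obtain F where F: "row_operation k F" "(F * ?C) $$ (j, j) = 1"
    "\<And>i c. i < k \<Longrightarrow> c < j \<Longrightarrow> (F * ?C) $$ (i, c) = (if i = c then 1 else 0)"
    "\<And>i. i < k \<Longrightarrow> i \<noteq> j \<Longrightarrow> (F * ?C) $$ (i, j) = 0"
    using eliminate_column[OF Cc j, of k] by auto
  have "F * ?C = F * (?T * ?S * E) * B"
    using F(1) ro B by (intro assoc_mult_mat[symmetric, of _ k k _ k _ k]) (auto simp: row_operation_def)
  moreover have "row_operation k (F * (?T * ?S * E))" using F(1) ro by (rule row_operation_mult)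
  moreover have "\<forall>i<k. \<forall>c<Suc j. (F * ?C) $$ (i, c) = (if i = c then 1 else 0)"
    using F by (auto simp: less_Suc_eq)
  ultimately show ?case by metis
qed

lemma invertible_mat_obtain:
  fixes A :: "'a::field mat"
  assumes "A \<in> carrier_mat k k" "det A \<noteq> 0"
  obtains B where "B \<in> carrier_mat k k" "A * B = 1\<^sub>m k" "B * A = 1\<^sub>m k" "det B \<noteq> 0"
proof -
  from det_non_zero_imp_unit[OF assms, of undefined]
  obtain B where B: "B \<in> carrier_mat k k" "A * B = 1\<^sub>m k" "B * A = 1\<^sub>m k"
    by (auto simp: Units_def ring_mat_def)
  have "det A * det B = det (A * B)" using det_mult[OF assms(1) B(1)] by simp
  hence "det B \<noteq> 0" using B by auto
  thus ?thesis using that B by blast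
qed

text \<open>Reducing the inverse \<open>B\<close> of \<open>A\<close> to the identity by some
  \<open>E\<close> forces \<open>E = A\<close>, which exhibits \<open>A\<close> itself as a
  composite of elementary row operations.\<close>

lemma row_operation_iff_det:
  fixes A :: "'a::field mat"
  assumes A: "A \<in> carrier_mat k k"
  shows "row_operation k A \<longleftrightarrow> det A \<noteq> 0"
proof
  assume "det A \<noteq> 0"
  then obtain B where B: "B \<in> carrier_mat k k" "A * B = 1\<^sub>m k" "B * A = 1\<^sub>m k" "det B \<noteq> 0"
    using A invertible_mat_obtain by blast
  then obtain E where E: "row_operation k E"
    "\<forall>i<k. \<forall>c<k. (E * B) $$ (i, c) = (if i = c then 1 else 0)"
    using row_reduction[OF B(1,4), of k] by blast
  have Ec: "E \<in> carrier_mat k k" using E by (simp add: row_operation_def)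
  have "E * B = 1\<^sub>m k" by (rule eq_matI) (use E Ec B in auto)
  hence "E * B * A = A" using A by simp
  moreover have "E * B * A = E * (B * A)" using Ec B A by simp
  ultimately have "E = A" using B Ec by simp
  thus "row_operation k A" using E by simp
qed (simp add: row_operation_def)

lemma matrix_steps_scale_cols:
  fixes M :: "'a::field mat"
  assumes M: "M \<in> carrier_mat k n" and c: "\<And>j. j < n \<Longrightarrow> c j \<noteq> 0"
  shows "matrix_step\<^sup>*\<^sup>* M (mat k n (\<lambda>(i, j). c j * M $$ (i, j)))"
proof -
  have "m \<le> n \<Longrightarrow> matrix_step\<^sup>*\<^sup>* M (mat k n (\<lambda>(i, j). (if j < m then c j else 1) * M $$ (i, j)))" for m
  proof (induction m)
    case 0
    have "mat k n (\<lambda>(i, j). (if j < 0 then c j else 1) * M $$ (i, j)) = M"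
      by (rule eq_matI) (use M in auto)
    thus ?case by simp
  next
    case (Suc m)
    let ?N = "\<lambda>m. mat k n (\<lambda>(i, j). (if j < m then c j else 1) * M $$ (i, j))"
    have "matrix_step (?N m) (multcol m (c m) (?N m))"
      using Suc.prems c by (intro matrix_step.scale_col) auto
    moreover have "multcol m (c m) (?N m) = ?N (Suc m)"
      by (rule eq_matI) (auto simp: less_Suc_eq)
    ultimately show ?case using Suc by (metis (no_types, lifting) Suc_leD rtranclp.rtrancl_into_rtrancl)
  qed
  from this[of n] have "matrix_step\<^sup>*\<^sup>* M (mat k n (\<lambda>(i, j). (if j < n then c j else 1) * M $$ (i, j)))" by simp
  moreover have "mat k n (\<lambda>(i, j). (if j < n then c j else 1) * M $$ (i, j)) = mat k n (\<lambda>(i, j). c j * M $$ (i, j))"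
    by (rule eq_matI) auto
  ultimately show ?thesis by simp
qed

section \<open>Linear equivalence through the standard basis\<close>

lemma basis_family_unit_vecs: "basis_family k (unit_vecs k :: 'a::field vec list)"
proof -
  interpret vec_space "TYPE('a)" k .
  show ?thesis using unit_vecs_basis unit_vecs_distinct by (simp add: basis_family_def)
qed

lemma coords_unit_vecs:
  fixes x :: "'a::field vec"
  assumes "x \<in> carrier_vec k"
  shows "coords k (unit_vecs k) x = x"
proof -
  have "mat_of_cols k (unit_vecs k) = (1\<^sub>m k :: 'a mat)"
    by (rule eq_matI) (auto simp: mat_of_cols_def unit_vecs_def)
  thus ?thesis using assms unfolding coords_def by (intro the_equality) auto
qed

text \<open>The witness for the basis is the standard one, where coordinates change nothing. The
  steps are then the row operations composing \<open>A\<close>, one column permutation, and the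
  column scalings.\<close>

lemma linearly_equivalentI:
  fixes G R :: "'a::field vec list"
  assumes G: "set G \<subseteq> carrier_vec k" "length G = n" and R: "set R \<subseteq> carrier_vec k" "length R = n"
    and A: "A \<in> carrier_mat k k" "det A \<noteq> 0" and \<sigma>: "\<sigma> permutes {..<n}"
    and c: "\<And>j. j < n \<Longrightarrow> c j \<noteq> 0"
    and eq: "\<And>j. j < n \<Longrightarrow> R ! j = c j \<cdot>\<^sub>v (A *\<^sub>v (G ! \<sigma> j))"
  shows "linearly_equivalent k G R"
proof -
  have cm: "coord_matrix k (unit_vecs k) X = mat_of_cols k X" if "set X \<subseteq> carrier_vec k" for X :: "'a vec list"
  proof -
    have "map (coords k (unit_vecs k)) X = map (\<lambda>x. x) X"
      using that by (intro map_cong) (auto simp: coords_unit_vecs)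
    thus ?thesis by (simp add: coord_matrix_def)
  qed
  let ?M = "mat_of_cols k G"
  have M: "?M \<in> carrier_mat k n" using G by (metis mat_of_cols_carrier(1))
  let ?N = "mat k n (\<lambda>(i, j). (A * ?M) $$ (i, \<sigma> j))"
  have "row_operation k A" using A row_operation_iff_det by blast
  hence steps1: "matrix_step\<^sup>*\<^sup>* ?M (A * ?M)" using M by (auto simp: row_operation_def)
  have steps2: "matrix_step (A * ?M) ?N"
    using matrix_step.permute_cols[of \<sigma> "A * ?M"] \<sigma> A G(2) by simp
  have steps3: "matrix_step\<^sup>*\<^sup>* ?N (mat k n (\<lambda>(i, j). c j * ?N $$ (i, j)))"
    using c by (intro matrix_steps_scale_cols) auto
  have "mat k n (\<lambda>(i, j). c j * ?N $$ (i, j)) = mat_of_cols k R"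
  proof (rule eq_matI)
    fix i j assume "i < dim_row (mat_of_cols k R)" "j < dim_col (mat_of_cols k R)"
    hence ij: "i < k" "j < n" using R by auto
    have sj: "\<sigma> j < n" using permutes_in_image[OF \<sigma>, of j] ij by simp
    have gc: "G ! \<sigma> j \<in> carrier_vec k" using sj G by (metis nth_mem subsetD)
    have "col ?M (\<sigma> j) = G ! \<sigma> j" using sj G gc by (intro col_mat_of_cols) auto
    thus "mat k n (\<lambda>(i, j). c j * ?N $$ (i, j)) $$ (i, j) = mat_of_cols k R $$ (i, j)"
      using ij sj A G R eq[OF ij(2)] by (simp add: mat_of_cols_index)
  qed (use R in auto)
  hence "matrix_step\<^sup>*\<^sup>* ?M (mat_of_cols k R)"
    using rtranclp_trans[OF rtranclp.rtrancl_into_rtrancl[OF steps1 steps2] steps3] by simp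
  thus ?thesis
    unfolding linearly_equivalent_def using basis_family_unit_vecs cm G(1) R(1) by metis
qed

section \<open>Arcs and inclusion matrices\<close>

text \<open>The solution \<open>x\<close> of the recursion
  \<open>i * x (i - 1) + (k - 1 - i) * x i = 0\<close> for \<open>0 < i < k - 1\<close>, normalised
  by \<open>(k - 1) * x (k - 2) = 1\<close>.\<close>

definition inclusion_weight :: "nat \<Rightarrow> nat \<Rightarrow> 'a::field" where
  "inclusion_weight k j = (-1) ^ (k - 2 - j) * of_nat (fact (k - 2 - j) * fact j) / of_nat (fact (k - 1))"

lemma fact_nonzero_CHAR:
  assumes "m < CHAR('a::field)"
  shows "of_nat (fact m) \<noteq> (0 :: 'a)"
  using assms
proof (induction m)
  case (Suc m)
  have "of_nat (Suc m) \<noteq> (0::'a)"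
    using Suc.prems by (subst of_nat_eq_0_iff_char_dvd) (auto dest: dvd_imp_le)
  thus ?case using Suc by (simp only: fact_Suc of_nat_mult of_nat_id) auto
qed simp

text \<open>If \<open>C\<close> has \<open>i\<close> points in \<open>K\<close>, deleting one of
  them leaves \<open>i - 1\<close> and deleting another point leaves \<open>i\<close>, so the sum is
  the left side of the recursion behind the weights. The recursion starts at \<open>i = 1\<close>,
  hence the condition that \<open>C\<close> meets \<open>K\<close>.\<close>

lemma sum_inclusion_weight:
  assumes k: "2 \<le> k" "k \<le> CHAR('a::field)" and fin: "finite C" and C: "card C = k - 1"
    and ne: "C \<inter> K \<noteq> {}"
  shows "(\<Sum>c\<in>C. inclusion_weight k (card ((C - {c}) \<inter> K)) :: 'a) = (if C \<subseteq> K then 1 else 0)"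
proof -
  define i where "i = card (C \<inter> K)"
  have f: "of_nat (fact (k - 1)) \<noteq> (0::'a)" using k by (intro fact_nonzero_CHAR) auto
  have i0: "i > 0" using ne fin by (simp add: i_def card_gt_0_iff)
  have split: "C = (C \<inter> K) \<union> (C - K)" by auto
  have cs: "card (C - K) = k - 1 - i" "i \<le> k - 1"
    using fin C card_mono[of C "C \<inter> K"] by (auto simp: i_def card_Diff_subset_Int)
  have "(\<Sum>c\<in>C. inclusion_weight k (card ((C - {c}) \<inter> K)) :: 'a) =
    (\<Sum>c\<in>C \<inter> K. inclusion_weight k (card ((C - {c}) \<inter> K))) +
    (\<Sum>c\<in>C - K. inclusion_weight k (card ((C - {c}) \<inter> K)))"
    by (subst split, rule sum.union_disjoint) (use fin in auto)
  also have "(\<Sum>c\<in>C \<inter> K. inclusion_weight k (card ((C - {c}) \<inter> K)) :: 'a) = (\<Sum>c\<in>C \<inter> K. inclusion_weight k (i - 1))"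
  proof (rule sum.cong)
    fix c assume c: "c \<in> C \<inter> K"
    have "(C - {c}) \<inter> K = (C \<inter> K) - {c}" by auto
    thus "inclusion_weight k (card ((C - {c}) \<inter> K)) = inclusion_weight k (i - 1)"
      using c fin by (simp add: i_def)
  qed simp
  also have "(\<Sum>c\<in>C - K. inclusion_weight k (card ((C - {c}) \<inter> K)) :: 'a) = (\<Sum>c\<in>C - K. inclusion_weight k i)"
  proof (rule sum.cong)
    fix c assume c: "c \<in> C - K"
    have "(C - {c}) \<inter> K = C \<inter> K" using c by auto
    thus "inclusion_weight k (card ((C - {c}) \<inter> K)) = inclusion_weight k i" by (simp add: i_def)
  qed simp
  finally have eq: "(\<Sum>c\<in>C. inclusion_weight k (card ((C - {c}) \<inter> K)) :: 'a) =
      of_nat i * inclusion_weight k (i - 1) + of_nat (k - 1 - i) * inclusion_weight k i"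
    by (simp add: cs i_def)
  show ?thesis
  proof (cases "C \<subseteq> K")
    case True
    hence "i = k - 1" using C by (simp add: i_def Int_absorb2)
    moreover obtain m where "k - 1 = Suc m" using k by (cases "k - 1") auto
    ultimately show ?thesis unfolding eq using True f
      by (simp add: inclusion_weight_def algebra_simps)
  next
    case False
    hence "i \<noteq> k - 1" using C fin
      by (metis Int_lower1 card_subset_eq i_def inf.absorb_iff1)
    hence ik: "i < k - 1" using cs by simp
    define m where "m = k - 2 - i"
    obtain i' where i': "i = Suc i'" using i0 by (cases i) auto
    have m: "k - 2 - (i - 1) = Suc m" "k - 1 - i = Suc m" "k - 2 - i = m"
      using ik i0 k by (auto simp: m_def)
    have "of_nat i * inclusion_weight k (i - 1) + of_nat (k - 1 - i) * inclusion_weight k i = (0::'a)"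
      unfolding inclusion_weight_def m unfolding i' using f by (simp add: field_simps)
    thus ?thesis using False eq by simp
  qed
qed

text \<open>The indicator of the facets of \<open>K\<close> is a combination of columns of the
  inclusion matrix, and \<open>w\<close> is orthogonal to every column. Concretely, pairs
  \<open>(C, c)\<close> with \<open>c\<close> in \<open>C\<close> are recounted as pairs
  \<open>(C - {c}, c)\<close>.\<close>

lemma sum_over_facets_zero:
  fixes w :: "'b set \<Rightarrow> 'a::field"
  assumes k: "2 \<le> k" "k \<le> CHAR('a)" and G: "finite G" "card G = 2 * k - 2"
    and K: "K \<subseteq> G" "card K = k"
    and zero: "\<And>Y. Y \<subseteq> G \<Longrightarrow> card Y = k - 2 \<Longrightarrow> (\<Sum>a\<in>G - Y. w (insert a Y)) = 0"
  shows "(\<Sum>i\<in>K. w (K - {i})) = 0"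
proof -
  let ?x = "\<lambda>A. inclusion_weight k (card (A \<inter> K)) :: 'a"
  define \<C> where "\<C> = {C. C \<subseteq> G \<and> card C = k - 1}"
  define \<A> where "\<A> = {A. A \<subseteq> G \<and> card A = k - 2}"
  have fin: "finite \<C>" "finite \<A>" using G by (auto simp: \<C>_def \<A>_def)
  have finK: "finite K" using G K finite_subset by blast
  have finC: "finite C" if "C \<subseteq> G" for C using G that finite_subset by blast
  \<comment> \<open>Disjoint sets of sizes \<open>k - 1\<close> and \<open>k\<close> do not fit into
    \<open>2 * k - 2\<close> elements.\<close>
  have ne: "C \<inter> K \<noteq> {}" if C: "C \<in> \<C>" for C
  proof
    assume "C \<inter> K = {}"
    hence "card (C \<union> K) = card C + card K" using C finK finC by (intro card_Un_disjoint) (auto simp: \<C>_def)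
    moreover have "card (C \<union> K) \<le> card G" using C K G by (intro card_mono) (auto simp: \<C>_def)
    ultimately show False using C K G k by (auto simp: \<C>_def)
  qed
  have "(\<Sum>i\<in>K. w (K - {i})) = (\<Sum>C\<in>{C \<in> \<C>. C \<subseteq> K}. w C)"
  proof (rule sum.reindex_bij_betw[where h = "\<lambda>i. K - {i}"])
    show "bij_betw (\<lambda>i. K - {i}) K {C \<in> \<C>. C \<subseteq> K}"
      unfolding bij_betw_def
    proof
      show "inj_on (\<lambda>i. K - {i}) K" by (auto intro!: inj_onI)
      show "(\<lambda>i. K - {i}) ` K = {C \<in> \<C>. C \<subseteq> K}"
      proof (intro equalityI subsetI)
        fix C assume "C \<in> {C \<in> \<C>. C \<subseteq> K}"
        hence C: "C \<subseteq> K" "card C = k - 1" by (auto simp: \<C>_def)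
        hence "card (K - C) = 1" using K finK k by (subst card_Diff_subset) (auto intro: finite_subset)
        then obtain i where i: "K - C = {i}" by (auto simp: card_1_singleton_iff)
        hence "C = K - {i}" "i \<in> K" using C by auto
        thus "C \<in> (\<lambda>i. K - {i}) ` K" by blast
      qed (use K finK in \<open>auto simp: \<C>_def\<close>)
    qed
  qed
  also have "\<dots> = (\<Sum>C\<in>\<C>. if C \<subseteq> K then w C else 0)"
    using fin by (simp add: sum.inter_filter)
  also have "\<dots> = (\<Sum>C\<in>\<C>. \<Sum>c\<in>C. w C * ?x (C - {c}))"
  proof (rule sum.cong)
    fix C assume C: "C \<in> \<C>"
    have "(\<Sum>c\<in>C. w C * ?x (C - {c})) = w C * (\<Sum>c\<in>C. ?x (C - {c}))" by (simp add: sum_distrib_left)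
    also have "\<dots> = w C * (if C \<subseteq> K then 1 else 0)"
      using sum_inclusion_weight[OF k finC _ ne[OF C]] C by (simp add: \<C>_def)
    finally show "(if C \<subseteq> K then w C else 0) = (\<Sum>c\<in>C. w C * ?x (C - {c}))" by simp
  qed simp
  also have "\<dots> = (\<Sum>(C, c)\<in>(SIGMA C:\<C>. C). w C * ?x (C - {c}))"
    by (rule sum.Sigma) (use fin finC in \<open>auto simp: \<C>_def\<close>)
  also have "\<dots> = (\<Sum>(A, a)\<in>(SIGMA A:\<A>. G - A). w (insert a A) * ?x A)"
    by (rule sum.reindex_bij_witness[of _ "\<lambda>(A, a). (insert a A, a)" "\<lambda>(C, c). (C - {c}, c)"])
      (use k finC in \<open>auto simp: \<A>_def \<C>_def insert_absorb card_insert_if\<close>)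
  also have "\<dots> = (\<Sum>A\<in>\<A>. \<Sum>a\<in>G - A. w (insert a A) * ?x A)"
    by (rule sum.Sigma[symmetric]) (use fin G in auto)
  also have "\<dots> = (\<Sum>A\<in>\<A>. (\<Sum>a\<in>G - A. w (insert a A)) * ?x A)" by (simp add: sum_distrib_right)
  also have "\<dots> = 0" using zero by (intro sum.neutral) (auto simp: \<A>_def)
  finally show ?thesis .
qed

section \<open>Arcs as indexed families\<close>

text \<open>With a function in place of a list, linear maps act pointwise; allowing index lists in
  any order spares sorting whenever points are appended to a subfamily.\<close>

definition arc_on :: "nat \<Rightarrow> nat \<Rightarrow> (nat \<Rightarrow> 'a::field vec) \<Rightarrow> bool" where
  "arc_on k n g \<longleftrightarrow> (\<forall>j<n. g j \<in> carrier_vec k) \<and>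
     (\<forall>js. distinct js \<and> length js = k \<and> set js \<subseteq> {..<n} \<longrightarrow> det (mat_of_cols k (map g js)) \<noteq> 0)"

text \<open>Listing a subfamily in another order changes neither its set of vectors nor, the length
  being the same, its distinctness.\<close>

lemma arc_iff_arc_on:
  fixes G :: "'a::field vec list"
  shows "arc k G \<longleftrightarrow> k \<le> length G \<and> arc_on k (length G) ((!) G)"
proof -
  let ?n = "length G"
  have same: "basis_family k (nths G (set js)) \<longleftrightarrow> det (mat_of_cols k (map ((!) G) js)) \<noteq> 0"
    if js: "distinct js" "length js = k" "set js \<subseteq> {..<?n}" and c: "\<forall>j<?n. G ! j \<in> carrier_vec k" for js
  proof -
    have set: "set (nths G (set js)) = set (map ((!) G) js)" using js(3) by (auto simp: set_nths)
    have len: "length (nths G (set js)) = length (map ((!) G) js)"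
    proof -
      have "{i. i < ?n \<and> i \<in> set js} = set js" using js by auto
      thus ?thesis using js by (simp add: length_nths distinct_card)
    qed
    have "distinct (nths G (set js)) \<longleftrightarrow> distinct (map ((!) G) js)"
      using set len by (metis card_distinct distinct_card)
    hence "basis_family k (nths G (set js)) \<longleftrightarrow> basis_family k (map ((!) G) js)"
      unfolding basis_family_def set by simp
    thus ?thesis using js c by (subst (asm) basis_family_iff_det) auto
  qed
  have carr: "set G \<subseteq> carrier_vec k \<longleftrightarrow> (\<forall>j<?n. G ! j \<in> carrier_vec k)"
    by (auto simp: set_conv_nth)
  show ?thesis
  proof
    assume a: "arc k G"
    hence c: "\<forall>j<?n. G ! j \<in> carrier_vec k" using carr by (auto simp: arc_def)
    have "det (mat_of_cols k (map ((!) G) js)) \<noteq> 0"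
      if js: "distinct js" "length js = k" "set js \<subseteq> {..<?n}" for js
      using a same[OF js c] js distinct_card[of js] unfolding arc_def by auto
    thus "k \<le> ?n \<and> arc_on k ?n ((!) G)" using a c by (auto simp: arc_on_def arc_def)
  next
    assume a: "k \<le> ?n \<and> arc_on k ?n ((!) G)"
    hence c: "\<forall>j<?n. G ! j \<in> carrier_vec k" by (auto simp: arc_on_def)
    have "basis_family k (nths G I)" if I: "I \<subseteq> {..<?n}" "card I = k" for I
    proof -
      have fin: "finite I" using I finite_subset by blast
      let ?js = "sorted_list_of_set I"
      have js: "distinct ?js" "length ?js = k" "set ?js \<subseteq> {..<?n}" using I fin by auto
      hence "basis_family k (nths G (set ?js))" using same[OF js c] a unfolding arc_on_def by blast
      thus ?thesis using fin by simp
    qed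
    thus "arc k G" using a c carr by (auto simp: arc_def)
  qed
qed

text \<open>The kernel criterion for the transposed matrix: the columns lie on a common hyperplane
  with normal vector \<open>y\<close>.\<close>

lemma det_mat_of_cols_zero_left:
  fixes vs :: "'a::field vec list"
  assumes vs: "set vs \<subseteq> carrier_vec k" "length vs = k"
  shows "det (mat_of_cols k vs) = 0 \<longleftrightarrow> (\<exists>y\<in>carrier_vec k. y \<noteq> 0\<^sub>v k \<and> (\<forall>v\<in>set vs. v \<bullet> y = 0))"
proof -
  let ?P = "mat_of_cols k vs"
  have P: "?P \<in> carrier_mat k k" using vs by (metis mat_of_cols_carrier(1))
  have PT: "?P\<^sup>T \<in> carrier_mat k k" using P by simp
  have "?P\<^sup>T *\<^sub>v y = 0\<^sub>v k \<longleftrightarrow> (\<forall>v\<in>set vs. v \<bullet> y = 0)" if y: "y \<in> carrier_vec k" for y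
  proof -
    have row: "row (?P\<^sup>T) i = vs ! i" if "i < k" for i
      using that vs P by (simp add: subset_iff)
    have "?P\<^sup>T *\<^sub>v y = 0\<^sub>v k \<longleftrightarrow> (\<forall>i<k. (vs ! i) \<bullet> y = 0)"
    proof
      assume eq: "?P\<^sup>T *\<^sub>v y = 0\<^sub>v k"
      have "(vs ! i) \<bullet> y = 0" if i: "i < k" for i
      proof -
        have "(?P\<^sup>T *\<^sub>v y) $ i = row (?P\<^sup>T) i \<bullet> y" using i vs by simp
        thus ?thesis using eq row[OF i] i by simp
      qed
      thus "\<forall>i<k. (vs ! i) \<bullet> y = 0" by blast
    next
      assume z: "\<forall>i<k. (vs ! i) \<bullet> y = 0"
      show "?P\<^sup>T *\<^sub>v y = 0\<^sub>v k"
      proof (rule eq_vecI)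
        fix i assume "i < dim_vec (0\<^sub>v k)"
        hence i: "i < k" by simp
        hence "(?P\<^sup>T *\<^sub>v y) $ i = row (?P\<^sup>T) i \<bullet> y" using vs by simp
        thus "(?P\<^sup>T *\<^sub>v y) $ i = 0\<^sub>v k $ i" using z row[OF i] i by simp
      qed (use vs in simp)
    qed
    thus ?thesis using vs by (auto simp: set_conv_nth)
  qed
  thus ?thesis using det_0_iff_vec_prod_zero_field[OF PT] det_transpose[OF P] by auto
qed

lemma arc_on_annihilator:
  assumes arc: "arc_on k n g" and J: "J \<subseteq> {..<n}" "card J = k" and y: "y \<in> carrier_vec k"
    and zero: "\<And>j. j \<in> J \<Longrightarrow> g j \<bullet> y = 0"
  shows "y = 0\<^sub>v k"
proof (rule ccontr)
  assume "y \<noteq> 0\<^sub>v k"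
  let ?js = "sorted_list_of_set J"
  have fin: "finite J" using J finite_subset by blast
  have js: "distinct ?js" "length ?js = k" "set ?js \<subseteq> {..<n}" using J fin by auto
  hence "det (mat_of_cols k (map g ?js)) \<noteq> 0" using arc unfolding arc_on_def by blast
  moreover have "set (map g ?js) \<subseteq> carrier_vec k" using arc js by (auto simp: arc_on_def)
  ultimately show False
    using det_mat_of_cols_zero_left[of "map g ?js" k] js fin y zero \<open>y \<noteq> 0\<^sub>v k\<close> by auto
qed

lemma arc_on_independent:
  assumes arc: "arc_on k n g" and J: "J \<subseteq> {..<n}" "card J = k"
    and zero: "\<And>i. i < k \<Longrightarrow> (\<Sum>j\<in>J. c j * g j $ i) = 0" and j: "j \<in> J"
  shows "c j = 0"
proof (rule ccontr)
  assume cj: "c j \<noteq> 0"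
  let ?js = "sorted_list_of_set J"
  have fin: "finite J" using J finite_subset by blast
  have js: "distinct ?js" "length ?js = k" "set ?js \<subseteq> {..<n}" using J fin by auto
  let ?P = "mat_of_cols k (map g ?js)"
  have P: "?P \<in> carrier_mat k k" using js by (metis length_map mat_of_cols_carrier(1))
  define v where "v = vec k (\<lambda>m. c (?js ! m))"
  have v: "v \<in> carrier_vec k" by (simp add: v_def)
  have bij: "bij_betw ((!) ?js) {..<k} J" using js fin by (intro bij_betw_nth) auto
  have "j \<in> (!) ?js ` {..<k}" using bij_betw_imp_surj_on[OF bij] j by simp
  then obtain m where m: "m < k" "?js ! m = j" by (elim imageE) simp
  hence "v $ m \<noteq> 0\<^sub>v k $ m" using cj by (simp add: v_def)
  hence "v \<noteq> 0\<^sub>v k" by metis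
  moreover have "?P *\<^sub>v v = 0\<^sub>v k"
  proof (rule eq_vecI)
    fix i assume "i < dim_vec (0\<^sub>v k)"
    hence i: "i < k" by simp
    have "(?P *\<^sub>v v) $ i = (\<Sum>m<k. ?P $$ (i, m) * v $ m)" by (rule mult_vec_index[OF P v i])
    also have "\<dots> = (\<Sum>m<k. c (?js ! m) * g (?js ! m) $ i)"
      using i js by (intro sum.cong) (auto simp: mat_of_cols_index v_def)
    also have "\<dots> = (\<Sum>j\<in>J. c j * g j $ i)" by (rule sum.reindex_bij_betw[OF bij])
    finally show "(?P *\<^sub>v v) $ i = 0\<^sub>v k $ i" using zero[OF i] i by simp
  qed simp
  ultimately have "det ?P = 0" using det_0_iff_vec_prod_zero_field[OF P] v by auto
  thus False using arc js unfolding arc_on_def by blast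
qed

section \<open>Determinants along a hyperplane\<close>

lemma det_mat_of_cols_permute_list:
  fixes vs :: "'a::field vec list"
  assumes "length vs = n" and p: "p permutes {..<n}"
  shows "det (mat_of_cols n (permute_list p vs)) = signof p * det (mat_of_cols n vs)"
proof -
  let ?A = "mat_of_cols n vs" and ?B = "mat_of_cols n (permute_list p vs)"
  have A: "?A \<in> carrier_mat n n" "?B \<in> carrier_mat n n"
    using assms by (metis length_permute_list mat_of_cols_carrier(1))+
  have pi: "p i < n" if "i < n" for i using permutes_in_image[OF p, of i] that by simp
  have "?B\<^sup>T = mat n n (\<lambda>(i, j). ?A\<^sup>T $$ (p i, j))"
    by (rule eq_matI) (use assms A pi in \<open>auto simp: mat_of_cols_index permute_list_nth\<close>)
  moreover have "det (mat n n (\<lambda>(i, j). ?A\<^sup>T $$ (p i, j))) = signof p * det (?A\<^sup>T)"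
    using A p by (intro det_permute_rows) (auto simp: atLeast0LessThan)
  ultimately show ?thesis using det_transpose A by metis
qed

text \<open>The permutation carrying \<open>c'\<close> to \<open>c\<close> is extended by fixing the
  last position, so that one sign serves every \<open>z\<close>.\<close>

lemma det_reorder_cols:
  fixes c c' :: "'a::field vec list"
  assumes "mset c = mset c'" "Suc (length c) = k"
  obtains \<epsilon> :: 'a where "\<epsilon> = 1 \<or> \<epsilon> = -1"
    "\<And>z. det (mat_of_cols k (c @ [z])) = \<epsilon> * det (mat_of_cols k (c' @ [z]))"
proof -
  have len: "length c = length c'" using assms(1) by (rule mset_eq_length)
  obtain p where p: "p permutes {..<length c'}" "permute_list p c' = c"
    using mset_eq_permutation[OF assms(1)] by blast
  have p': "p permutes {..<k}" by (rule permutes_subset[OF p(1)]) (use assms len in auto)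
  have fix_last: "p (length c') = length c'" using permutes_not_in[OF p(1)] by simp
  have "permute_list p (c' @ [z]) = c @ [z]" for z
  proof (rule nth_equalityI)
    fix i assume i: "i < length (permute_list p (c' @ [z]))"
    show "permute_list p (c' @ [z]) ! i = (c @ [z]) ! i"
    proof (cases "i < length c'")
      case True
      hence "p i < length c'" using permutes_in_image[OF p(1), of i] by simp
      moreover have "c ! i = c' ! p i" using permute_list_nth[OF p(1) True] p(2) by simp
      ultimately show ?thesis using i True p' len assms by (simp add: permute_list_nth nth_append)
    next
      case False
      hence "i = length c'" using i by simp
      thus ?thesis using p' fix_last len assms by (simp add: permute_list_nth nth_append)
    qed
  qed (use len in simp)
  hence "det (mat_of_cols k (c @ [z])) = signof p * det (mat_of_cols k (c' @ [z]))" for z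
    using det_mat_of_cols_permute_list[OF _ p', of "c' @ [z]"] assms len by simp
  moreover have "signof p = (1::'a) \<or> signof p = (-1::'a)" by (simp add: sign_def)
  ultimately show ?thesis by (intro that[of "signof p"])
qed

text \<open>Laplace expansion along the last column, whose cofactors do not involve
  \<open>z\<close>.\<close>

lemma det_linear_last_col:
  fixes c :: "'a::field vec list"
  assumes "Suc (length c) = k" "z \<in> carrier_vec k"
  shows "det (mat_of_cols k (c @ [z])) = (\<Sum>i<k. z $ i * det (mat_of_cols k (c @ [unit_vec k i])))"
proof -
  let ?A = "\<lambda>z. mat_of_cols k (c @ [z])"
  have A: "?A z \<in> carrier_mat k k" for z using assms(1) by (metis length_append_singleton mat_of_cols_carrier(1))
  have k: "k - 1 < k" using assms by simp
  have last: "?A z $$ (i, k - 1) = z $ i" if "i < k" for z i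
    using that assms(1) by (auto simp: mat_of_cols_index nth_append)
  have del: "mat_delete (?A z) i (k - 1) = mat_delete (?A z') i (k - 1)" if "i < k" for z z' i
    by (rule eq_matI) (use that assms(1) in \<open>auto simp: mat_delete_def mat_of_cols_index nth_append\<close>)
  have cof: "cofactor (?A z) i (k - 1) = cofactor (?A z') i (k - 1)" if "i < k" for z z' i
    unfolding cofactor_def by (simp only: del[OF that, of z z'])
  have exp: "det (?A z) = (\<Sum>i<k. z $ i * cofactor (?A (0\<^sub>v k)) i (k - 1))" for z
    unfolding laplace_expansion_column[OF A k]
  proof (rule sum.cong[OF refl])
    fix i assume "i \<in> {..<k}"
    hence i: "i < k" by simp
    show "?A z $$ (i, k - 1) * cofactor (?A z) i (k - 1) = z $ i * cofactor (?A (0\<^sub>v k)) i (k - 1)"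
      unfolding last[OF i] cof[OF i, of z "0\<^sub>v k"] ..
  qed
  have "det (?A (unit_vec k i)) = cofactor (?A (0\<^sub>v k)) i (k - 1)" if i: "i < k" for i
    unfolding exp using i by (simp add: unit_vec_def if_distrib[of "\<lambda>x. x * _"] cong: if_cong)
  thus ?thesis unfolding exp by (intro sum.cong) auto
qed

lemma mat_mult_mat_of_cols:
  assumes "M \<in> carrier_mat k k" "set vs \<subseteq> carrier_vec k"
  shows "M * mat_of_cols k vs = mat_of_cols k (map ((*\<^sub>v) M) vs)"
proof (rule eq_matI)
  fix i j assume "i < dim_row (mat_of_cols k (map ((*\<^sub>v) M) vs))" "j < dim_col (mat_of_cols k (map ((*\<^sub>v) M) vs))"
  hence ij: "i < k" "j < length vs" by auto
  hence "vs ! j \<in> carrier_vec k" using assms by (metis nth_mem subsetD)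
  thus "(M * mat_of_cols k vs) $$ (i, j) = mat_of_cols k (map ((*\<^sub>v) M) vs) $$ (i, j)"
    using ij assms by (simp add: mat_of_cols_index)
qed (use assms in auto)

lemma det_2x2:
  assumes A: "A \<in> carrier_mat 2 2"
  shows "det A = A $$ (0, 0) * A $$ (1, 1) - A $$ (0, 1) * A $$ (1, 0 :: nat)"
proof -
  have d: "dim_row A = 2" "dim_col A = 2" using A by auto
  have "det A = (\<Sum>j<2. A $$ (0, j) * cofactor A 0 j)" using A by (intro laplace_expansion_row) auto
  also have "\<dots> = A $$ (0, 0) * cofactor A 0 0 + A $$ (0, 1) * cofactor A 0 1"
    by (simp add: numeral_2_eq_2)
  also have "cofactor A 0 0 = A $$ (1, 1)"
    unfolding cofactor_def by (subst det_single) (auto simp: mat_delete_def d)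
  also have "cofactor A 0 1 = - A $$ (1, 0)"
    unfolding cofactor_def by (subst det_single) (auto simp: mat_delete_def d)
  finally show ?thesis by simp
qed

lemma det_identity_cols:
  fixes u v :: "'a::field vec"
  assumes "u \<in> carrier_vec (m + 2)" "v \<in> carrier_vec (m + 2)"
  shows "det (mat_of_cols (m + 2) (map (unit_vec (m + 2)) [0..<m] @ [u, v])) =
    u $ m * v $ (m + 1) - v $ m * u $ (m + 1)"
proof -
  let ?C = "mat 2 2 (\<lambda>(i, j). (if j = 0 then u else v) $ (m + i))"
  let ?B = "mat m 2 (\<lambda>(i, j). (if j = 0 then u else v) $ i)"
  have "mat_of_cols (m + 2) (map (unit_vec (m + 2)) [0..<m] @ [u, v]) =
      four_block_mat (1\<^sub>m m) ?B (0\<^sub>m 2 m) ?C"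
    by (rule eq_matI) (auto simp: mat_of_cols_index nth_append nth_Cons' less_Suc_eq)
  also have "det \<dots> = det (1\<^sub>m m) * det ?C"
    by (rule det_four_block_mat_lower_left_zero) auto
  also have "det ?C = u $ m * v $ (m + 1) - v $ m * u $ (m + 1)" by (subst det_2x2) auto
  finally show ?thesis by simp
qed

text \<open>After the base change \<open>M\<close> taking \<open>Y @ [y, x]\<close> to the unit
  vectors, only the last two coordinates of the free columns enter the determinant. They are
  homogeneous coordinates \<open>(h, f)\<close> on the line obtained by projecting from the span of
  \<open>Y\<close>, and \<open>f\<close> vanishes at \<open>y\<close> because \<open>y\<close> comes
  before \<open>x\<close> in the basis.\<close>

lemma det_two_free_cols:
  fixes Y :: "'a::field vec list"
  assumes Y: "set Y \<subseteq> carrier_vec k" "length Y + 2 = k" and xy: "x \<in> carrier_vec k" "y \<in> carrier_vec k"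
    and nz: "det (mat_of_cols k (Y @ [y, x])) \<noteq> 0"
  obtains f h :: "'a vec \<Rightarrow> 'a" and d where "f y = 0"
    "\<And>z a. z \<in> carrier_vec k \<Longrightarrow> a \<in> carrier_vec k \<Longrightarrow>
      det (mat_of_cols k (Y @ [a, z])) = d * (f z * h a - h z * f a)"
proof -
  let ?P = "mat_of_cols k (Y @ [y, x])"
  have P: "?P \<in> carrier_mat k k" using mat_of_cols_carrier(1)[of k "Y @ [y, x]"] Y by simp
  obtain M where M: "M \<in> carrier_mat k k" "M * ?P = 1\<^sub>m k" "?P * M = 1\<^sub>m k" "det M \<noteq> 0"
    using invertible_mat_obtain[OF P nz] by metis
  have colP: "M *\<^sub>v ((Y @ [y, x]) ! j) = unit_vec k j" if j: "j < k" for j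
  proof -
    have "(Y @ [y, x]) ! j \<in> carrier_vec k" using j Y xy by (intro subsetD[OF _ nth_mem[of j]]) auto
    hence "col ?P j = (Y @ [y, x]) ! j" using j Y by (intro col_mat_of_cols) auto
    moreover have "col (M * ?P) j = M *\<^sub>v col ?P j" using j P M by (intro col_mult2) auto
    ultimately show ?thesis using M j by simp
  qed
  define m where "m = length Y"
  have m: "k = m + 2" using Y by (simp add: m_def)
  have MY: "map ((*\<^sub>v) M) Y = map (unit_vec k) [0..<m]"
  proof (rule nth_equalityI)
    fix j assume "j < length (map ((*\<^sub>v) M) Y)"
    hence j: "j < m" by (simp add: m_def)
    have "(Y @ [y, x]) ! j = Y ! j" using j by (simp add: nth_append m_def)
    thus "map ((*\<^sub>v) M) Y ! j = map (unit_vec k) [0..<m] ! j" using colP[of j] j m by (simp add: m_def)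
  qed (simp add: m_def)
  have My: "M *\<^sub>v y = unit_vec k m" using colP[of m] m by (simp add: m_def nth_append)
  define f where "f z = (M *\<^sub>v z) $ (m + 1)" for z
  define h where "h z = (M *\<^sub>v z) $ m" for z
  have "f y = 0" by (simp add: f_def My m)
  moreover have "det (mat_of_cols k (Y @ [a, z])) = (1 / det M) * (f z * h a - h z * f a)"
    if za: "z \<in> carrier_vec k" "a \<in> carrier_vec k" for z a
  proof -
    have c: "mat_of_cols k (Y @ [a, z]) \<in> carrier_mat k k"
      using mat_of_cols_carrier(1)[of k "Y @ [a, z]"] Y by simp
    have "det M * det (mat_of_cols k (Y @ [a, z])) = det (M * mat_of_cols k (Y @ [a, z]))"
      using det_mult[OF M(1) c] by simp
    also have "M * mat_of_cols k (Y @ [a, z]) = mat_of_cols k (map (unit_vec k) [0..<m] @ [M *\<^sub>v a, M *\<^sub>v z])"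
      using M za Y by (subst mat_mult_mat_of_cols) (auto simp: MY)
    also have "det \<dots> = f z * h a - h z * f a"
      unfolding m using M za by (subst det_identity_cols) (auto simp: f_def h_def m)
    finally show ?thesis using M(4) by (simp add: field_simps)
  qed
  ultimately show ?thesis by (rule that)
qed

text \<open>A linear form in the vector \<open>g z\<close> that vanishes on the points of
  \<open>C\<close>; sorting \<open>C\<close> fixes its sign.\<close>

definition hyperplane_form :: "nat \<Rightarrow> (nat \<Rightarrow> 'a::field vec) \<Rightarrow> nat set \<Rightarrow> nat \<Rightarrow> 'a" where
  "hyperplane_form k g C z = det (mat_of_cols k (map g (sorted_list_of_set C) @ [g z]))"

text \<open>There are \<open>CARD('a) + 1\<close> factors when \<open>card I = CARD('a) + 1\<close> and \<open>card G = 2 * k - 2\<close>, so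
  the product does not depend on the ordering of \<open>C\<close> that is used in \<^const>\<open>hyperplane_form\<close>. This
  replaces Segre's lemma of tangents.\<close>

definition facet_product :: "nat \<Rightarrow> (nat \<Rightarrow> 'a::field vec) \<Rightarrow> nat set \<Rightarrow> nat set \<Rightarrow> nat set \<Rightarrow> 'a" where
  "facet_product k g I G C =
     (\<Prod>z\<in>I - C. hyperplane_form k g C z) * (\<Prod>z\<in>G - C. hyperplane_form k g C z)"

lemma hyperplane_form_nonzero:
  assumes arc: "arc_on k n g" and C: "C \<subseteq> {..<n}" "Suc (card C) = k" and z: "z < n" "z \<notin> C"
  shows "hyperplane_form k g C z \<noteq> 0"
proof -
  have fin: "finite C" using C finite_subset by blast
  have "det (mat_of_cols k (map g (sorted_list_of_set C @ [z]))) \<noteq> 0"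
    using arc C z fin unfolding arc_on_def
    by (elim conjE allE[of _ "sorted_list_of_set C @ [z]"]) auto
  thus ?thesis by (simp add: hyperplane_form_def)
qed

text \<open>Projection from \<open>Y\<close> turns the hyperplane forms of the sets
  \<open>insert a Y\<close> into 2 by 2 determinants, and \<open>projective_line_sum_zero\<close>
  applies to the images of the arc and of \<open>G\<close>.\<close>

lemma sum_facet_product_zero:
  fixes g :: "nat \<Rightarrow> 'a::{field,finite} vec"
  assumes arc: "arc_on k (CARD('a) + 1) g" and k: "2 \<le> k"
    and G: "G \<subseteq> {..<CARD('a) + 1}" "card G = 2 * k - 2" and Y: "Y \<subseteq> G" "card Y = k - 2"
  shows "(\<Sum>a\<in>G - Y. 1 / facet_product k g {..<CARD('a) + 1} G (insert a Y)) = 0"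
proof -
  let ?n = "CARD('a) + 1" and ?q = "CARD('a)"
  let ?Y = "sorted_list_of_set Y"
  define I where "I = {..<?n} - Y"
  define E where "E = G - Y"
  have fin: "finite G" "finite Y" "finite I" "finite E"
    using G Y finite_subset[of G "{..<?n}"] finite_subset[of Y G] by (auto simp: I_def E_def)
  have YI: "Y \<subseteq> {..<?n}" using Y G by blast
  have EI: "E \<subseteq> I" using G by (auto simp: E_def I_def)
  have le: "2 * k - 2 \<le> ?n" using card_mono[OF _ G(1)] G by simp
  have cI: "card I = ?n - (k - 2)" unfolding I_def using fin YI Y by (simp add: card_Diff_subset)
  have cE: "card E = k" unfolding E_def using fin Y G k by (simp add: card_Diff_subset)
  have gc: "g j \<in> carrier_vec k" if "j < ?n" for j using arc that by (simp add: arc_on_def)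
  define D where "D z a = det (mat_of_cols k (map g ?Y @ [g a, g z]))" for z a
  have nz: "D z a \<noteq> 0" if "z \<in> I" "a \<in> I" "z \<noteq> a" for z a
  proof -
    have "det (mat_of_cols k (map g (?Y @ [a, z]))) \<noteq> 0"
      using arc that fin YI Y k unfolding arc_on_def
      by (elim conjE allE[of _ "?Y @ [a, z]"]) (auto simp: I_def)
    thus ?thesis by (simp add: D_def)
  qed
  have "2 \<le> card E" using cE k by simp
  then obtain E2 where "E2 \<subseteq> E" "card E2 = 2" by (meson obtain_subset_with_card_n)
  then obtain x y where xy: "x \<in> E" "y \<in> E" "x \<noteq> y" by (auto simp: card_2_iff)
  have xyI: "x \<in> I" "y \<in> I" using xy EI by auto
  hence xyn: "x < ?n" "y < ?n" by (auto simp: I_def)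
  have Yc: "set (map g ?Y) \<subseteq> carrier_vec k" "length (map g ?Y) + 2 = k"
    using fin gc YI Y k by auto
  have nz': "det (mat_of_cols k (map g ?Y @ [g y, g x])) \<noteq> 0"
    using nz[OF xyI xy(3)] by (simp add: D_def)
  obtain f h :: "'a vec \<Rightarrow> 'a" and d where f: "f (g y) = 0" and
    fh: "\<And>z a. z \<in> carrier_vec k \<Longrightarrow> a \<in> carrier_vec k \<Longrightarrow>
      det (mat_of_cols k (map g ?Y @ [a, z])) = d * (f z * h a - h z * f a)"
    by (rule det_two_free_cols[OF Yc gc[OF xyn(1)] gc[OF xyn(2)] nz']) (rule that)
  have zero: "(\<Sum>a\<in>E. 1 / ((\<Prod>z\<in>I - {a}. D z a) * (\<Prod>z\<in>E - {a}. D z a))) = 0"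
  proof (rule projective_line_sum_zero[where f = "f \<circ> g" and h = "h \<circ> g" and d = d and y = y])
    show "D z a = d * ((f \<circ> g) z * (h \<circ> g) a - (h \<circ> g) z * (f \<circ> g) a)" if "z \<in> I" "a \<in> I" for z a
      unfolding D_def comp_def using that gc by (intro fh) (auto simp: I_def)
    \<comment> \<open>Outside \<open>Y\<close> there are \<open>(q + 1) - (k - 2)\<close> points of
      the arc and \<open>k\<close> points of \<open>G\<close>.\<close>
    show "card I + card E = ?q + 3" using cI cE k le by simp
  qed (use fin EI cE k nz xy f in auto)
  have "facet_product k g {..<?n} G (insert a Y) = (\<Prod>z\<in>I - {a}. D z a) * (\<Prod>z\<in>E - {a}. D z a)"
    if a: "a \<in> E" for a
  proof -
    have aY: "a \<notin> Y" "a \<in> I" using a EI by (auto simp: E_def)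
    let ?C = "sorted_list_of_set (insert a Y)"
    have "Y - {a} = Y" using aY by blast
    hence "mset ?C = mset (?Y @ [a])" using fin by simp
    hence "mset (map g ?C) = mset (map g (?Y @ [a]))" unfolding mset_map by simp
    moreover have "Suc (length (map g ?C)) = k" using fin aY Y k by simp
    ultimately obtain \<epsilon> :: 'a where \<epsilon>: "\<epsilon> = 1 \<or> \<epsilon> = -1"
      "\<And>z. det (mat_of_cols k (map g ?C @ [z])) = \<epsilon> * det (mat_of_cols k (map g (?Y @ [a]) @ [z]))"
      by (rule det_reorder_cols) (rule that)
    \<comment> \<open>Replacing the sorted order of \<open>insert a Y\<close> by \<open>Y\<close>
      followed by \<open>a\<close> costs a sign that may depend on \<open>a\<close> but not on
      \<open>z\<close>.\<close>
    have hf: "hyperplane_form k g (insert a Y) z = \<epsilon> * D z a" for z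
      unfolding hyperplane_form_def \<epsilon>(2) D_def by simp
    have "{..<?n} - insert a Y = I - {a}" "G - insert a Y = E - {a}" by (auto simp: I_def E_def)
    hence "facet_product k g {..<?n} G (insert a Y) =
        \<epsilon> ^ (card (I - {a}) + card (E - {a})) * ((\<Prod>z\<in>I - {a}. D z a) * (\<Prod>z\<in>E - {a}. D z a))"
      unfolding facet_product_def hf by (simp add: prod.distrib power_add)
    \<comment> \<open>The sign occurs \<open>q + 1\<close> times and therefore drops out.\<close>
    also have "card (I - {a}) + card (E - {a}) = ?q + 1" using fin a aY cI cE k le by simp
    also have "\<epsilon> ^ (?q + 1) = 1" unfolding finite_field_power_card_plus_1 using \<epsilon>(1) by auto
    finally show ?thesis by simp
  qed
  thus ?thesis using zero unfolding E_def[symmetric] by simp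
qed

section \<open>Relations between inverse coordinates of a normalised arc\<close>

text \<open>The unit vectors other than the \<open>i\<close>-th span the coordinate hyperplane on
  which coordinate \<open>i\<close> vanishes, so the form is a multiple of that coordinate.\<close>

lemma hyperplane_form_normalised:
  fixes g :: "nat \<Rightarrow> 'a::field vec"
  assumes unit: "\<And>j. j < k \<Longrightarrow> g j = unit_vec k j" and i: "i < k" and z: "g z \<in> carrier_vec k"
  shows "hyperplane_form k g ({..<k} - {i}) z = g z $ i * hyperplane_form k g ({..<k} - {i}) i"
proof -
  let ?C = "{..<k} - {i}"
  let ?c = "map g (sorted_list_of_set ?C)"
  have len: "Suc (length ?c) = k" using i by simp
  have zero: "det (mat_of_cols k (?c @ [unit_vec k l])) = 0" if l: "l < k" "l \<noteq> i" for l
  proof -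
    have "l \<in> set (sorted_list_of_set ?C)" using l by simp
    then obtain m where m: "m < length ?c" "sorted_list_of_set ?C ! m = l"
      by (metis in_set_conv_nth length_map)
    have A: "mat_of_cols k (?c @ [unit_vec k l]) \<in> carrier_mat k k"
      using len by (metis length_append_singleton mat_of_cols_carrier(1))
    have "?c ! m = unit_vec k l" using m l unit by simp
    hence "col (mat_of_cols k (?c @ [unit_vec k l])) m = unit_vec k l"
      using m by (subst col_mat_of_cols) (auto simp: nth_append)
    moreover have "col (mat_of_cols k (?c @ [unit_vec k l])) (length ?c) = unit_vec k l"
      by (subst col_mat_of_cols) (auto simp: nth_append)
    moreover have "length ?c = k - 1" using len by simp
    ultimately have "col (mat_of_cols k (?c @ [unit_vec k l])) m = col (mat_of_cols k (?c @ [unit_vec k l])) (k - 1)"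
      by metis
    thus ?thesis using m len by (intro det_identical_cols[OF A, of m "k - 1"]) auto
  qed
  have "hyperplane_form k g ?C z = (\<Sum>l<k. g z $ l * det (mat_of_cols k (?c @ [unit_vec k l])))"
    unfolding hyperplane_form_def by (rule det_linear_last_col[OF len z])
  also have "\<dots> = (\<Sum>l<k. if l = i then g z $ i * det (mat_of_cols k (?c @ [unit_vec k i])) else 0)"
    using zero by (intro sum.cong) auto
  also have "\<dots> = g z $ i * det (mat_of_cols k (?c @ [unit_vec k i]))" using i by simp
  also have "unit_vec k i = g i" using unit i by simp
  finally show ?thesis by (simp add: hyperplane_form_def)
qed

lemma normalised_arc_nonzero:
  assumes arc: "arc_on k n g" and unit: "\<And>j. j < k \<Longrightarrow> g j = unit_vec k j" and kn: "k \<le> n"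
    and i: "i < k" and z: "k \<le> z" "z < n"
  shows "g z $ i \<noteq> 0"
proof -
  have "hyperplane_form k g ({..<k} - {i}) z \<noteq> 0"
    by (rule hyperplane_form_nonzero[OF arc]) (use i z kn in auto)
  moreover have "g z \<in> carrier_vec k" using arc z by (simp add: arc_on_def)
  ultimately show ?thesis using hyperplane_form_normalised[OF unit i] by auto
qed

text \<open>This is \<open>sum_over_facets_zero\<close> with \<open>K\<close> the unit vectors and
  \<open>w\<close> the inverse facet product, which factors into powers of single
  coordinates.\<close>

lemma reciprocal_relation:
  fixes g :: "nat \<Rightarrow> 'a::{field,finite} vec"
  assumes arc: "arc_on k (CARD('a) + 1) g" and unit: "\<And>j. j < k \<Longrightarrow> g j = unit_vec k j"
    and k: "2 \<le> k" "k \<le> CHAR('a)" and kn: "k \<le> CARD('a) + 1"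
  obtains \<beta> where "\<And>i. i < k \<Longrightarrow> \<beta> i \<noteq> 0"
    "\<And>L. L \<subseteq> {k..<CARD('a) + 1} \<Longrightarrow> card L = k - 2 \<Longrightarrow> (\<Sum>i<k. \<beta> i / (\<Prod>z\<in>L. g z $ i)) = 0"
proof -
  let ?n = "CARD('a) + 1"
  define \<phi> where "\<phi> i z = hyperplane_form k g ({..<k} - {i}) z" for i z
  \<comment> \<open>The part of the inverse facet product independent of \<open>L\<close>. Of the
    \<open>k\<close> factors \<open>\<phi> i i\<close>, two come from \<open>z = i\<close> in the
    two products and \<open>k - 2\<close> from expressing the forms at \<open>L\<close> by
    coordinates.\<close>
  define \<beta> where "\<beta> i = 1 / ((\<Prod>z\<in>{k..<?n}. \<phi> i z) * \<phi> i i ^ k)" for i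
  have gc: "g z \<in> carrier_vec k" if "z < ?n" for z using arc that by (simp add: arc_on_def)
  have \<phi>: "\<phi> i z = g z $ i * \<phi> i i" if "i < k" "z < ?n" for i z
    unfolding \<phi>_def by (rule hyperplane_form_normalised[OF unit that(1) gc[OF that(2)]])
  have nz: "\<phi> i z \<noteq> 0" if "i < k" "z < ?n" "z = i \<or> k \<le> z" for i z
    unfolding \<phi>_def by (rule hyperplane_form_nonzero[OF arc]) (use that kn in auto)
  have "\<beta> i \<noteq> 0" if "i < k" for i
    using nz that kn by (auto simp: \<beta>_def)
  moreover have "(\<Sum>i<k. \<beta> i / (\<Prod>z\<in>L. g z $ i)) = 0" if L: "L \<subseteq> {k..<?n}" "card L = k - 2" for L
  proof -
    let ?G = "{..<k} \<union> L"
    have finL: "finite L" using L finite_subset by blast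
    have G: "?G \<subseteq> {..<?n}" using L kn by auto
    have "card ?G = card {..<k} + card L" using L finL by (intro card_Un_disjoint) auto
    hence cG: "card ?G = 2 * k - 2" using L k by simp
    have "(\<Sum>i\<in>{..<k}. 1 / facet_product k g {..<?n} ?G ({..<k} - {i})) = 0"
    proof (rule sum_over_facets_zero[OF k _ cG, where w = "\<lambda>C. 1 / facet_product k g {..<?n} ?G C"])
      fix Y assume "Y \<subseteq> ?G" "card Y = k - 2"
      thus "(\<Sum>a\<in>?G - Y. 1 / facet_product k g {..<?n} ?G (insert a Y)) = 0"
        by (rule sum_facet_product_zero[OF arc k(1) G cG])
    qed (use finL in auto)
    moreover have "1 / facet_product k g {..<?n} ?G ({..<k} - {i}) = \<beta> i / (\<Prod>z\<in>L. g z $ i)"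
      if "i \<in> {..<k}" for i
    proof -
      have i: "i < k" using that by simp
      have "{..<?n} - ({..<k} - {i}) = insert i {k..<?n}" "?G - ({..<k} - {i}) = insert i L"
        using i kn L by auto
      moreover have notL: "i \<notin> L" using L i by auto
      ultimately have "facet_product k g {..<?n} ?G ({..<k} - {i}) =
          (\<phi> i i * (\<Prod>z\<in>{k..<?n}. \<phi> i z)) * (\<phi> i i * (\<Prod>z\<in>L. \<phi> i z))"
        using i finL notL by (simp add: facet_product_def \<phi>_def)
      also have "(\<Prod>z\<in>L. \<phi> i z) = (\<Prod>z\<in>L. g z $ i * \<phi> i i)"
        using L i by (intro prod.cong \<phi>) auto
      also have "\<dots> = (\<Prod>z\<in>L. g z $ i) * \<phi> i i ^ (k - 2)" using L by (simp add: prod.distrib)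
      also have "(\<phi> i i * (\<Prod>z\<in>{k..<?n}. \<phi> i z)) * (\<phi> i i * ((\<Prod>z\<in>L. g z $ i) * \<phi> i i ^ (k - 2))) =
          (\<Prod>z\<in>{k..<?n}. \<phi> i z) * \<phi> i i ^ Suc (Suc (k - 2)) * (\<Prod>z\<in>L. g z $ i)" by simp
      also have "Suc (Suc (k - 2)) = k" using k by simp
      finally show ?thesis by (simp add: \<beta>_def)
    qed
    ultimately show ?thesis by simp
  qed
  ultimately show ?thesis by (rule that)
qed

text \<open>A vanishing minor would give a hyperplane, with normal \<open>y\<close>, through
  \<open>g u\<close>, \<open>g v\<close> and the \<open>k - 2\<close> unit vectors other than those
  at \<open>i\<close> and \<open>l\<close>.\<close>

lemma normalised_arc_2x2:
  assumes arc: "arc_on k n g" and unit: "\<And>j. j < k \<Longrightarrow> g j = unit_vec k j"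
    and uv: "k \<le> u" "u < n" "k \<le> v" "v < n" "u \<noteq> v" and il: "i < k" "l < k" "i \<noteq> l"
  shows "g u $ i * g v $ l \<noteq> g u $ l * g v $ i"
proof
  assume eq: "g u $ i * g v $ l = g u $ l * g v $ i"
  define y where "y = vec k (\<lambda>m. if m = i then g u $ l else if m = l then - g u $ i else 0)"
  have y: "y \<in> carrier_vec k" by (simp add: y_def)
  have gy: "g j \<bullet> y = g j $ i * g u $ l - g j $ l * g u $ i" for j
  proof -
    have "g j \<bullet> y = (\<Sum>m<k. g j $ m * y $ m)" by (simp add: scalar_prod_def y_def atLeast0LessThan)
    also have "\<dots> = (\<Sum>m<k. (if m = i then g j $ i * g u $ l else 0) + (if m = l then - (g j $ l * g u $ i) else 0))"
      using il by (intro sum.cong) (auto simp: y_def)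
    also have "\<dots> = g j $ i * g u $ l - g j $ l * g u $ i" using il by (simp add: sum.distrib)
    finally show ?thesis .
  qed
  let ?J = "insert u (insert v ({..<k} - {i, l}))"
  have "card ({..<k} - {i, l}) = k - 2" using il by (subst card_Diff_subset) auto
  hence "card ?J = k" using uv il by simp
  moreover have "?J \<subseteq> {..<n}" using uv by auto
  moreover have "g j \<bullet> y = 0" if "j \<in> ?J" for j
    using that eq unit il unfolding gy by (auto simp: algebra_simps)
  ultimately have "y = 0\<^sub>v k" using arc_on_annihilator[OF arc _ _ y] by blast
  hence "y $ i = 0" using il by simp
  hence "g u $ l = 0" using il by (simp add: y_def)
  thus False using normalised_arc_nonzero[OF arc unit _ il(2) uv(1,2)] uv by simp
qed

lemma cramer_2x2:
  fixes u0 :: "'a::field"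
  assumes "u0 * v1 - u1 * v0 \<noteq> 0"
  shows "\<exists>s t. x0 = s * u0 + t * v0 \<and> x1 = s * u1 + t * v1"
proof -
  define \<Delta> where "\<Delta> = u0 * v1 - u1 * v0"
  define s where "s = x0 * v1 - x1 * v0"
  define t where "t = u0 * x1 - u1 * x0"
  have "s * u0 + t * v0 = \<Delta> * x0" "s * u1 + t * v1 = \<Delta> * x1"
    by (simp_all add: \<Delta>_def s_def t_def algebra_simps)
  hence "x0 = (s / \<Delta>) * u0 + (t / \<Delta>) * v0" "x1 = (s / \<Delta>) * u1 + (t / \<Delta>) * v1"
    using assms by (simp_all add: \<Delta>_def[symmetric] add_divide_distrib[symmetric])
  thus ?thesis by blast
qed

text \<open>Only \<open>s\<close> and \<open>t\<close> with agreement in the first two coordinates have to be found: the difference,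
  suitably rescaled, annihilates the first two unit vectors and the vectors in \<open>R\<close>, which are
  \<open>k\<close> vectors of the arc.\<close>

lemma reciprocals_collinear:
  fixes g :: "nat \<Rightarrow> 'a::{field,finite} vec"
  assumes arc: "arc_on k (CARD('a) + 1) g" and unit: "\<And>j. j < k \<Longrightarrow> g j = unit_vec k j"
    and k: "2 \<le> k" "k \<le> CHAR('a)" and kq: "2 * k \<le> CARD('a)"
    and x: "k \<le> x" "x < CARD('a) + 1"
  shows "\<exists>s t. \<forall>i<k. 1 / g x $ i = s / g k $ i + t / g (k + 1) $ i"
proof -
  let ?n = "CARD('a) + 1"
  have kn: "k \<le> ?n" and u: "k < ?n" and v: "k + 1 < ?n" using kq k by auto
  note nz = normalised_arc_nonzero[OF arc unit kn]
  consider "x = k" | "x = k + 1" | "x \<noteq> k" "x \<noteq> k + 1" by blast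
  thus ?thesis
  proof cases
    case 1 thus ?thesis by (intro exI[of _ 1] exI[of _ 0]) auto
  next
    case 2 thus ?thesis by (intro exI[of _ 0] exI[of _ 1]) auto
  next
    case 3
    define w where "w z i = 1 / g z $ i" for z i
    have "card ({k..<?n} - {k, k + 1, x}) = ?n - k - 3"
      using 3 x v by (subst card_Diff_subset) auto
    \<comment> \<open>The room provided by \<open>2 * k \<le> q\<close>: there are
      \<open>q - k - 2\<close> points left for the choice of \<open>R\<close>.\<close>
    hence "k - 2 \<le> card ({k..<?n} - {k, k + 1, x})" using kq by simp
    then obtain R where R: "R \<subseteq> {k..<?n} - {k, k + 1, x}" "card R = k - 2" "finite R"
      by (meson obtain_subset_with_card_n)
    obtain \<beta> where \<beta>: "\<And>i. i < k \<Longrightarrow> \<beta> i \<noteq> 0"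
      and rel: "\<And>L. L \<subseteq> {k..<?n} \<Longrightarrow> card L = k - 2 \<Longrightarrow> (\<Sum>i<k. \<beta> i / (\<Prod>z\<in>L. g z $ i)) = 0"
      by (rule reciprocal_relation[OF arc unit k kn]) (assumption, rule that)
    define \<gamma> where "\<gamma> i = \<beta> i / (\<Prod>z\<in>R. g z $ i)" for i
    have Rnz: "g z $ i \<noteq> 0" if "z \<in> R" "i < k" for z i using nz[of i z] R that by auto
    have \<gamma>: "\<gamma> i \<noteq> 0" if "i < k" for i using \<beta> Rnz R that by (auto simp: \<gamma>_def)
    have orth: "(\<Sum>i<k. g r $ i * (\<gamma> i * w z i)) = 0" if r: "r \<in> R" and z: "z \<in> {k, k + 1, x}" for r z
    proof -
      \<comment> \<open>Exchanging \<open>r\<close> for \<open>z\<close> in \<open>R\<close>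
        multiplies term \<open>i\<close> by \<open>g r $ i / g z $ i\<close>. The relation for the
        exchanged set thus becomes linear in the inverse coordinates of \<open>z\<close>, with the
        fixed weights \<open>\<gamma>\<close>.\<close>
      let ?L = "insert z (R - {r})"
      have zR: "z \<notin> R" using z R by auto
      have k3: "k - 2 > 0" using r R by (metis card_gt_0_iff empty_iff)
      have "card ?L = k - 2" using zR R r k3 by simp
      moreover have "?L \<subseteq> {k..<?n}" using R z x v by auto
      ultimately have "(\<Sum>i<k. \<beta> i / (\<Prod>z\<in>?L. g z $ i)) = 0" by (intro rel)
      moreover have "\<beta> i / (\<Prod>z\<in>?L. g z $ i) = g r $ i * (\<gamma> i * w z i)" if i: "i < k" for i
        using zR R(3) r Rnz[OF r i] by (simp add: prod_diff1 \<gamma>_def w_def mult_ac)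
      ultimately show ?thesis by simp
    qed
    have i01: "0 < k" "1 < k" using k by auto
    define \<Delta> where "\<Delta> = w k 0 * w (k + 1) 1 - w k 1 * w (k + 1) 0"
    have g0: "g k $ 0 \<noteq> 0" "g k $ 1 \<noteq> 0" "g (k + 1) $ 0 \<noteq> 0" "g (k + 1) $ 1 \<noteq> 0"
      using nz i01 u v by auto
    have "g k $ 0 * g (k + 1) $ 1 \<noteq> g k $ 1 * g (k + 1) $ 0"
      by (rule normalised_arc_2x2[OF arc unit]) (use u v i01 in auto)
    hence \<Delta>: "\<Delta> \<noteq> 0" using g0 by (simp add: \<Delta>_def w_def field_simps)
    obtain s t where st: "w x 0 = s * w k 0 + t * w (k + 1) 0" "w x 1 = s * w k 1 + t * w (k + 1) 1"
      using cramer_2x2[OF \<Delta>[unfolded \<Delta>_def]] by blast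
    define e where "e i = w x i - s * w k i - t * w (k + 1) i" for i
    have e01: "e 0 = 0" "e 1 = 0" using st by (simp_all add: e_def)
    define y where "y = vec k (\<lambda>i. \<gamma> i * e i)"
    have y: "y \<in> carrier_vec k" by (simp add: y_def)
    have gy: "g j \<bullet> y = (\<Sum>i<k. g j $ i * (\<gamma> i * e i))" for j
      by (simp add: scalar_prod_def y_def atLeast0LessThan)
    let ?J = "insert 0 (insert 1 R)"
    have "card ?J = k" using R k by (subst card_insert_disjoint; auto)+
    moreover have "?J \<subseteq> {..<?n}" using R k kn by auto
    moreover have "g j \<bullet> y = 0" if jJ: "j \<in> ?J" for j
    proof -
      consider "j = 0 \<or> j = 1" | "j \<in> R" using jJ by blast
      thus ?thesis
      proof cases
        case 1
        hence "j < k" "e j = 0" using e01 i01 by auto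
        hence "g j \<bullet> y = (\<Sum>i<k. if i = j then \<gamma> j * e j else 0)"
          unfolding gy using unit by (intro sum.cong) auto
        thus ?thesis using \<open>e j = 0\<close> by simp
      next
        case 2
        have "g j \<bullet> y = (\<Sum>i<k. g j $ i * (\<gamma> i * w x i)) - s * (\<Sum>i<k. g j $ i * (\<gamma> i * w k i))
            - t * (\<Sum>i<k. g j $ i * (\<gamma> i * w (k + 1) i))"
          unfolding gy e_def sum_distrib_left sum_subtractf[symmetric]
          by (intro sum.cong) (auto simp: algebra_simps)
        thus ?thesis using orth[OF 2] by simp
      qed
    qed
    ultimately have "y = 0\<^sub>v k" using arc_on_annihilator[OF arc _ _ y] by blast
    hence "e i = 0" if "i < k" for i
    proof -
      have "y $ i = 0" using \<open>y = 0\<^sub>v k\<close> that by simp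
      thus ?thesis using \<gamma>[OF that] that by (simp add: y_def)
    qed
    hence "\<forall>i<k. 1 / g x $ i = s / g k $ i + t / g (k + 1) $ i"
      by (auto simp: e_def w_def algebra_simps)
    thus ?thesis by blast
  qed
qed

section \<open>The normal rational curve\<close>

text \<open>The type \<open>'a option\<close> stands for the projective line, with
  \<open>None\<close> as the point at infinity. For \<open>k = 1\<close> distinct parameters give
  the same vector, so parameters rather than vectors index the curve.\<close>

definition nrc_point :: "nat \<Rightarrow> 'a::field option \<Rightarrow> 'a vec" where
  "nrc_point k P = (case P of None \<Rightarrow> unit_vec k (k - 1) | Some t \<Rightarrow> vec k (\<lambda>i. t ^ i))"

lemma nrc_point_carrier [simp]: "nrc_point k P \<in> carrier_vec k"
  by (cases P) (auto simp: nrc_point_def)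

lemma dim_nrc_point [simp]: "dim_vec (nrc_point k P) = k"
  by (rule carrier_vecD) simp

text \<open>A hyperplane with normal \<open>y\<close> meets the curve at roots of the polynomial
  \<open>p\<close> with coefficients \<open>y\<close>, of degree at most \<open>k - 1\<close>.
  Containing the point at infinity kills the coefficient of degree \<open>k - 1\<close>, so
  \<open>k\<close> parameters are too many in either case.\<close>

lemma arc_on_nrc_point:
  fixes \<rho> :: "nat \<Rightarrow> 'a::field option"
  assumes inj: "inj_on \<rho> {..<n}" and k: "1 \<le> k"
  shows "arc_on k n (\<lambda>j. nrc_point k (\<rho> j))"
  unfolding arc_on_def
proof (intro conjI allI impI)
  fix js assume js: "distinct js \<and> length js = k \<and> set js \<subseteq> {..<n}"
  let ?vs = "map (\<lambda>j. nrc_point k (\<rho> j)) js"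
  show "det (mat_of_cols k ?vs) \<noteq> 0"
  proof
    assume "det (mat_of_cols k ?vs) = 0"
    then obtain y where y: "y \<in> carrier_vec k" "y \<noteq> 0\<^sub>v k"
      and zero: "\<And>j. j \<in> set js \<Longrightarrow> nrc_point k (\<rho> j) \<bullet> y = 0"
      using js by (subst (asm) det_mat_of_cols_zero_left) auto
    define p where "p = (\<Sum>i<k. monom (y $ i) i)"
    have coeff: "coeff p i = (if i < k then y $ i else 0)" for i
      by (simp add: p_def coeff_sum)
    obtain i where "i < k" "y $ i \<noteq> 0" using y by (auto simp: vec_eq_iff)
    hence pnz: "p \<noteq> 0" using coeff[of i] by auto
    have deg: "degree p \<le> k - 1" by (rule degree_le) (use coeff k in auto)
    have val: "vec k (\<lambda>i. t ^ i) \<bullet> y = poly p t" for t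
      using y by (simp add: p_def poly_sum poly_monom scalar_prod_def atLeast0LessThan mult.commute)
    define T where "T = {t. Some t \<in> \<rho> ` set js}"
    have "T \<subseteq> {t. poly p t = 0}"
    proof
      fix t assume "t \<in> T"
      then obtain j where j: "j \<in> set js" "\<rho> j = Some t" by (auto simp: T_def)
      show "t \<in> {t. poly p t = 0}" using zero[OF j(1)] val[of t] j(2) by (simp add: nrc_point_def)
    qed
    hence cT: "card T \<le> degree p"
      using card_mono[OF poly_roots_finite[OF pnz]] card_poly_roots_bound[OF pnz] order_trans by blast
    have "card (\<rho> ` set js) = k"
      using js inj_on_subset[OF inj, of "set js"] by (simp add: card_image distinct_card)
    moreover have im: "\<rho> ` set js - {None} = Some ` T"
    proof (intro equalityI subsetI)
      fix P assume "P \<in> \<rho> ` set js - {None}"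
      thus "P \<in> Some ` T" by (cases P) (simp_all add: T_def)
    qed (auto simp: T_def)
    moreover have "card (Some ` T) = card T" by (simp add: card_image)
    ultimately have c: "card T = (if None \<in> \<rho> ` set js then k - 1 else k)"
      by (metis Diff_empty Diff_insert0 card_Diff_singleton)
    show False
    proof (cases "None \<in> \<rho> ` set js")
      case True
      then obtain j where j: "j \<in> set js" "\<rho> j = None" by auto
      have "y $ (k - 1) = 0" using zero[OF j(1)] j(2) y k by (simp add: nrc_point_def)
      hence "coeff p (k - 1) = 0" using coeff by simp
      moreover have "degree p = k - 1" using c cT deg True by simp
      ultimately show False using pnz by (metis leading_coeff_0_iff)
    next
      case False thus False using c cT deg k by simp
    qed
  qed
qed simp

text \<open>For \<open>n = q + 1\<close> injectivity makes \<open>\<rho>\<close> a bijection onto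
  the projective line, so the image is the whole curve up to order and scalars.\<close>

definition nrc_equivalent :: "nat \<Rightarrow> nat \<Rightarrow> (nat \<Rightarrow> 'a::field vec) \<Rightarrow> bool" where
  "nrc_equivalent k n g \<longleftrightarrow> (\<exists>A \<rho> c. A \<in> carrier_mat k k \<and> det A \<noteq> 0 \<and> inj_on \<rho> {..<n} \<and>
     (\<forall>j<n. c j \<noteq> 0 \<and> A *\<^sub>v g j = c j \<cdot>\<^sub>v nrc_point k (\<rho> j)))"

lemma arc_on_mult:
  assumes arc: "arc_on k n g" and M: "M \<in> carrier_mat k k" "det M \<noteq> 0"
  shows "arc_on k n (\<lambda>j. M *\<^sub>v g j)"
  unfolding arc_on_def
proof (intro conjI allI impI)
  fix js assume js: "distinct js \<and> length js = k \<and> set js \<subseteq> {..<n}"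
  have gc: "set (map g js) \<subseteq> carrier_vec k" using arc js by (auto simp: arc_on_def)
  have "map (\<lambda>j. M *\<^sub>v g j) js = map ((*\<^sub>v) M) (map g js)" by simp
  hence "mat_of_cols k (map (\<lambda>j. M *\<^sub>v g j) js) = M * mat_of_cols k (map g js)"
    using mat_mult_mat_of_cols[OF M(1) gc] by (simp only:)
  moreover have "mat_of_cols k (map g js) \<in> carrier_mat k k"
    using js mat_of_cols_carrier(1)[of k "map g js"] by simp
  ultimately have "det (mat_of_cols k (map (\<lambda>j. M *\<^sub>v g j) js)) = det M * det (mat_of_cols k (map g js))"
    using det_mult[OF M(1)] by metis
  moreover have "det (mat_of_cols k (map g js)) \<noteq> 0" using arc js unfolding arc_on_def by blast
  ultimately show "det (mat_of_cols k (map (\<lambda>j. M *\<^sub>v g j) js)) \<noteq> 0" using M by simp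
qed (use arc M in \<open>auto simp: arc_on_def\<close>)

lemma arc_on_normalise:
  fixes g :: "nat \<Rightarrow> 'a::field vec"
  assumes arc: "arc_on k n g" and kn: "k \<le> n"
  obtains M where "M \<in> carrier_mat k k" "det M \<noteq> 0" "\<And>j. j < k \<Longrightarrow> M *\<^sub>v g j = unit_vec k j"
proof -
  let ?P = "mat_of_cols k (map g [0..<k])"
  have P: "?P \<in> carrier_mat k k" using mat_of_cols_carrier(1)[of k "map g [0..<k]"] by simp
  have "det ?P \<noteq> 0" using arc kn unfolding arc_on_def
    by (elim conjE allE[of _ "[0..<k]"]) auto
  then obtain M where M: "M \<in> carrier_mat k k" "?P * M = 1\<^sub>m k" "M * ?P = 1\<^sub>m k" "det M \<noteq> 0"
    using invertible_mat_obtain[OF P] by metis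
  have "M *\<^sub>v g j = unit_vec k j" if j: "j < k" for j
  proof -
    have gj: "g j \<in> carrier_vec k" using arc kn j by (simp add: arc_on_def)
    have "col ?P j = g j" using j gj by (subst col_mat_of_cols) auto
    moreover have "col (M * ?P) j = M *\<^sub>v col ?P j" using j P M by (intro col_mult2) auto
    ultimately show ?thesis using M j by simp
  qed
  with M(1,4) show ?thesis by (rule that)
qed

lemma nrc_equivalent_mult:
  assumes gc: "\<And>j. j < n \<Longrightarrow> g j \<in> carrier_vec k" and M: "M \<in> carrier_mat k k" "det M \<noteq> 0"
    and eq: "nrc_equivalent k n (\<lambda>j. M *\<^sub>v g j)"
  shows "nrc_equivalent k n g"
proof -
  from eq obtain A \<rho> c where A: "A \<in> carrier_mat k k" "det A \<noteq> 0" "inj_on \<rho> {..<n}"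
    "\<And>j. j < n \<Longrightarrow> c j \<noteq> 0 \<and> A *\<^sub>v (M *\<^sub>v g j) = c j \<cdot>\<^sub>v nrc_point k (\<rho> j)"
    unfolding nrc_equivalent_def by blast
  have "A * M *\<^sub>v g j = A *\<^sub>v (M *\<^sub>v g j)" if "j < n" for j
    using A(1) M(1) gc[OF that] by (intro assoc_mult_mat_vec)
  moreover have "A * M \<in> carrier_mat k k" "det (A * M) \<noteq> 0"
    using A M det_mult[OF A(1) M(1)] by auto
  ultimately show ?thesis unfolding nrc_equivalent_def using A(3,4)
    by (intro exI[of _ "A * M"] exI[of _ \<rho>] exI[of _ c]) auto
qed

text \<open>Two indices with the same parameter would have proportional vectors; extending them to
  \<open>k\<close> points of the arc contradicts independence.\<close>

lemma projectively_injective: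
  assumes arc: "arc_on k n g" and k: "2 \<le> k" "k \<le> n" and A: "A \<in> carrier_mat k k" "det A \<noteq> 0"
    and eq: "\<And>j. j < n \<Longrightarrow> c j \<noteq> 0 \<and> A *\<^sub>v g j = c j \<cdot>\<^sub>v v (\<rho> j)"
    and v: "\<And>P. v P \<in> carrier_vec k"
  shows "inj_on \<rho> {..<n}"
proof (rule inj_onI, rule ccontr)
  fix i j assume ij: "i \<in> {..<n}" "j \<in> {..<n}" "\<rho> i = \<rho> j" "i \<noteq> j"
  have "card ({..<n} - {i, j}) = n - 2" using ij by (subst card_Diff_subset) auto
  then obtain J where J: "J \<subseteq> {..<n} - {i, j}" "card J = k - 2" "finite J"
    using k by (metis diff_le_mono obtain_subset_with_card_n)
  let ?J = "insert i (insert j J)"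
  have ninJ: "i \<notin> J" "j \<notin> J" using J by auto
  have cJ: "card ?J = k" using ninJ J ij k by simp
  have JS: "?J \<subseteq> {..<n}" using J ij by auto
  have gc: "g i \<in> carrier_vec k" "g j \<in> carrier_vec k" using arc ij by (auto simp: arc_on_def)
  let ?d = "c j \<cdot>\<^sub>v g i - c i \<cdot>\<^sub>v g j"
  have "A *\<^sub>v ?d = c j \<cdot>\<^sub>v (A *\<^sub>v g i) - c i \<cdot>\<^sub>v (A *\<^sub>v g j)"
    using A gc by (simp add: mult_minus_distrib_mat_vec[of _ k k] mult_mat_vec[of _ k k])
  also have "\<dots> = c j \<cdot>\<^sub>v (c i \<cdot>\<^sub>v v (\<rho> j)) - c i \<cdot>\<^sub>v (c j \<cdot>\<^sub>v v (\<rho> j))"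
    using eq[of i] eq[of j] ij by simp
  also have "\<dots> = 0\<^sub>v k" using v[of "\<rho> j"] by (intro eq_vecI) auto
  finally have "A *\<^sub>v ?d = 0\<^sub>v k" .
  moreover have "?d \<in> carrier_vec k" using gc by simp
  ultimately have "?d = 0\<^sub>v k" using det_0_iff_vec_prod_zero_field[OF A(1)] A(2) by blast
  define e where "e m = (if m = i then c j else if m = j then - c i else 0)" for m
  have "(\<Sum>m\<in>?J. e m * g m $ l) = 0" if l: "l < k" for l
  proof -
    have "(\<Sum>m\<in>J. e m * g m $ l) = 0" using ninJ by (intro sum.neutral) (auto simp: e_def)
    hence "(\<Sum>m\<in>?J. e m * g m $ l) = c j * g i $ l - c i * g j $ l"
      using J(3) ninJ ij(4) by (simp add: e_def)
    also have "\<dots> = ?d $ l" using l gc by simp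
    finally show ?thesis using \<open>?d = 0\<^sub>v k\<close> l by simp
  qed
  hence "e i = 0" by (rule arc_on_independent[OF arc JS cJ]) auto
  thus False using eq[of j] ij by (simp add: e_def)
qed

section \<open>The case \<open>2 * k \<le> q\<close>: the Cremona image of a line\<close>

text \<open>The curve parametrised by \<open>(s : t)\<close>, which treats the point at infinity,
  \<open>s = 0\<close>, like all others.\<close>

definition homogeneous_point :: "nat \<Rightarrow> 'a::field \<Rightarrow> 'a \<Rightarrow> 'a vec" where
  "homogeneous_point k s t = vec k (\<lambda>m. s ^ (k - 1 - m) * t ^ m)"

lemma homogeneous_point_nrc:
  assumes "k \<ge> 1" "s \<noteq> 0 \<or> t \<noteq> 0"
  shows "\<exists>c P. c \<noteq> 0 \<and> homogeneous_point k s t = c \<cdot>\<^sub>v nrc_point k P"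
proof (cases "s = 0")
  case True
  have "homogeneous_point k s t = t ^ (k - 1) \<cdot>\<^sub>v nrc_point k None"
    by (rule eq_vecI) (use True assms in \<open>auto simp: homogeneous_point_def nrc_point_def power_0_left\<close>)
  thus ?thesis using True assms by (intro exI[of _ "t ^ (k - 1)"] exI[of _ None]) auto
next
  case False
  have "homogeneous_point k s t = s ^ (k - 1) \<cdot>\<^sub>v nrc_point k (Some (t / s))"
  proof (rule eq_vecI)
    fix i assume "i < dim_vec (s ^ (k - 1) \<cdot>\<^sub>v nrc_point k (Some (t / s)))"
    hence i: "i < k" by (simp add: nrc_point_def)
    hence "s ^ (k - 1) = s ^ (k - 1 - i) * s ^ i" by (simp flip: power_add)
    thus "homogeneous_point k s t $ i = (s ^ (k - 1) \<cdot>\<^sub>v nrc_point k (Some (t / s))) $ i"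
      using i False by (simp add: homogeneous_point_def nrc_point_def power_divide)
  qed (simp add: homogeneous_point_def nrc_point_def)
  thus ?thesis using False by (intro exI[of _ "s ^ (k - 1)"] exI[of _ "Some (t / s)"]) auto
qed

text \<open>Coefficients of a product of linear polynomials, paired with homogeneous monomials,
  evaluate the product of the corresponding linear forms. The degree bound is carried along because
  the induction step needs the next coefficient to vanish.\<close>

lemma homogeneous_prod_linear:
  fixes a b :: "'b \<Rightarrow> 'a::field"
  assumes "finite I"
  shows "(\<Sum>m\<le>card I. coeff (\<Prod>l\<in>I. [:a l, b l:]) m * (s ^ (card I - m) * t ^ m)) =
      (\<Prod>l\<in>I. a l * s + b l * t) \<and> degree (\<Prod>l\<in>I. [:a l, b l:]) \<le> card I"
  using assms
proof (induction I)
  case (insert x I)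
  define p where "p = (\<Prod>l\<in>I. [:a l, b l:])"
  define N where "N = card I"
  have deg: "degree p \<le> N" and IH: "(\<Sum>m\<le>N. coeff p m * (s ^ (N - m) * t ^ m)) = (\<Prod>l\<in>I. a l * s + b l * t)"
    using insert by (auto simp: p_def N_def)
  have cN: "coeff p (Suc N) = 0" using deg by (intro coeff_eq_0) simp
  let ?r = "[:a x, b x:] * p"
  have r: "?r = Polynomial.smult (a x) p + pCons 0 (Polynomial.smult (b x) p)" by simp
  have "(\<Sum>m\<le>Suc N. coeff ?r m * (s ^ (Suc N - m) * t ^ m)) =
    (\<Sum>m\<le>Suc N. a x * coeff p m * (s ^ (Suc N - m) * t ^ m)) +
    (\<Sum>m\<le>Suc N. coeff (pCons 0 (Polynomial.smult (b x) p)) m * (s ^ (Suc N - m) * t ^ m))"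
    unfolding r by (simp only: coeff_add coeff_smult distrib_right sum.distrib)
  also have "(\<Sum>m\<le>Suc N. a x * coeff p m * (s ^ (Suc N - m) * t ^ m)) =
      (\<Sum>m\<le>N. a x * coeff p m * (s ^ (Suc N - m) * t ^ m))" using cN by simp
  also have "\<dots> = a x * s * (\<Sum>m\<le>N. coeff p m * (s ^ (N - m) * t ^ m))"
    unfolding sum_distrib_left by (intro sum.cong) (auto simp: Suc_diff_le)
  also have "(\<Sum>m\<le>Suc N. coeff (pCons 0 (Polynomial.smult (b x) p)) m * (s ^ (Suc N - m) * t ^ m)) =
      b x * t * (\<Sum>m\<le>N. coeff p m * (s ^ (N - m) * t ^ m))"
    unfolding sum.atMost_Suc_shift sum_distrib_left by (simp add: mult_ac)
  finally have "(\<Sum>m\<le>Suc N. coeff ?r m * (s ^ (Suc N - m) * t ^ m)) =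
      (a x * s + b x * t) * (\<Prod>l\<in>I. a l * s + b l * t)"
    unfolding IH by (simp add: algebra_simps)
  moreover have "degree ?r \<le> Suc N"
    using deg degree_mult_le[of "[:a x, b x:]" p] degree_pCons_le[of "a x" "[:b x:]"] by simp
  ultimately show ?case using insert by (simp add: p_def N_def del: sum.atMost_Suc)
qed simp

text \<open>By \<open>reciprocals_collinear\<close>, a point \<open>g j\<close> with
  \<open>j \<ge> k\<close> has inverse coordinates \<open>a i * s + b i * t\<close>. Multiplying the
  point by the product of all of these gives, in coordinate \<open>i\<close>, the product over the
  \<open>l\<close> other than \<open>i\<close>, a form of degree \<open>k - 1\<close> in
  \<open>(s, t)\<close>. So a matrix \<open>Q\<close> takes points of the curve to multiples of the
  arc, and its inverse is the matrix sought.\<close>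

lemma nrc_equivalent_normalised:
  fixes g :: "nat \<Rightarrow> 'a::{field,finite} vec"
  assumes arc: "arc_on k (CARD('a) + 1) g" and unit: "\<And>j. j < k \<Longrightarrow> g j = unit_vec k j"
    and k: "2 \<le> k" "k \<le> CHAR('a)" and kq: "2 * k \<le> CARD('a)"
  shows "nrc_equivalent k (CARD('a) + 1) g"
proof -
  let ?n = "CARD('a) + 1"
  have kn: "k \<le> ?n" and u: "k < ?n" and v: "k + 1 < ?n" using kq k by auto
  note nz = normalised_arc_nonzero[OF arc unit kn]
  have gc: "g j \<in> carrier_vec k" if "j < ?n" for j using arc that by (simp add: arc_on_def)
  define a where "a i = 1 / g k $ i" for i
  define b where "b i = 1 / g (k + 1) $ i" for i
  have ab0: "a i \<noteq> 0" "b i \<noteq> 0" if "i < k" for i using nz that u v by (auto simp: a_def b_def)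
  have ab: "a l * b i - b l * a i \<noteq> 0" if "i < k" "l < k" "i \<noteq> l" for i l
  proof -
    have "g k $ i * g (k + 1) $ l \<noteq> g k $ l * g (k + 1) $ i"
      by (rule normalised_arc_2x2[OF arc unit]) (use u v that in auto)
    thus ?thesis using ab0[OF that(1)] ab0[OF that(2)] by (simp add: a_def b_def field_simps)
  qed
  define Q where "Q = mat k k (\<lambda>(i, m). coeff (\<Prod>l\<in>{..<k} - {i}. [:a l, b l:]) m)"
  have Q: "Q \<in> carrier_mat k k" by (simp add: Q_def)
  have hc: "homogeneous_point k s t \<in> carrier_vec k" for s t :: 'a by (simp add: homogeneous_point_def)
  have Qh: "(Q *\<^sub>v homogeneous_point k s t) $ i = (\<Prod>l\<in>{..<k} - {i}. a l * s + b l * t)" if i: "i < k" for s t i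
  proof -
    have c: "card ({..<k} - {i}) = k - 1" using i by simp
    have "(Q *\<^sub>v homogeneous_point k s t) $ i = (\<Sum>m<k. Q $$ (i, m) * homogeneous_point k s t $ m)"
      by (rule mult_vec_index[OF Q hc i])
    also have "\<dots> = (\<Sum>m\<le>k - 1. coeff (\<Prod>l\<in>{..<k} - {i}. [:a l, b l:]) m * (s ^ (k - 1 - m) * t ^ m))"
      using i by (intro sum.cong) (auto simp: Q_def homogeneous_point_def)
    also have "\<dots> = (\<Prod>l\<in>{..<k} - {i}. a l * s + b l * t)"
      using homogeneous_prod_linear[of "{..<k} - {i}" a b s t] unfolding c by simp
    finally show ?thesis .
  qed
  have pts: "\<exists>s t d. (s \<noteq> 0 \<or> t \<noteq> 0) \<and> d \<noteq> 0 \<and> Q *\<^sub>v homogeneous_point k s t = d \<cdot>\<^sub>v g j" if j: "j < ?n" for j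
  proof (cases "j < k")
    case True
    \<comment> \<open>The parameter \<open>(b j : - a j)\<close> is the zero of the
      \<open>j\<close>-th linear form, which divides every coordinate except the
      \<open>j\<close>-th; so the image is a multiple of the \<open>j\<close>-th unit
      vector.\<close>
    define d where "d = (\<Prod>l\<in>{..<k} - {j}. a l * b j + b l * (- a j))"
    have "d \<noteq> 0" using ab True by (auto simp: d_def)
    moreover have "Q *\<^sub>v homogeneous_point k (b j) (- a j) = d \<cdot>\<^sub>v g j"
    proof (rule eq_vecI)
      fix i assume "i < dim_vec (d \<cdot>\<^sub>v g j)"
      hence i: "i < k" using gc[OF j] by simp
      show "(Q *\<^sub>v homogeneous_point k (b j) (- a j)) $ i = (d \<cdot>\<^sub>v g j) $ i"
      proof (cases "i = j")
        case True thus ?thesis unfolding Qh[OF i] using i unit by (simp add: d_def)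
      next
        case False
        hence "(\<Prod>l\<in>{..<k} - {i}. a l * b j + b l * (- a j)) = 0"
          using \<open>j < k\<close> by (intro prod_zero bexI[of _ j]) auto
        thus ?thesis unfolding Qh[OF i] using i unit[OF \<open>j < k\<close>] False \<open>j < k\<close> by simp
      qed
    qed (use Q gc[OF j] in simp)
    moreover have "b j \<noteq> 0" using ab0 True by simp
    ultimately show ?thesis by blast
  next
    case False
    then obtain s t where st: "\<And>i. i < k \<Longrightarrow> 1 / g j $ i = s / g k $ i + t / g (k + 1) $ i"
      using reciprocals_collinear[OF arc unit k kq, of j] j by auto
    have eq: "a i * s + b i * t = 1 / g j $ i" if "i < k" for i
      using st[OF that] by (simp add: a_def b_def)
    have gnz: "g j $ i \<noteq> 0" if "i < k" for i using nz[of i j] that False j by simp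
    define d where "d = (\<Prod>l<k. 1 / g j $ l)"
    have "d \<noteq> 0" using gnz by (simp add: d_def)
    moreover have "Q *\<^sub>v homogeneous_point k s t = d \<cdot>\<^sub>v g j"
    proof (rule eq_vecI)
      fix i assume "i < dim_vec (d \<cdot>\<^sub>v g j)"
      hence i: "i < k" using gc[OF j] by simp
      have "(Q *\<^sub>v homogeneous_point k s t) $ i = (\<Prod>l\<in>{..<k} - {i}. 1 / g j $ l)"
        unfolding Qh[OF i] by (intro prod.cong) (auto simp: eq)
      also have "\<dots> = d * g j $ i"
        using i gnz[OF i] by (simp add: d_def prod.remove[of "{..<k}" i])
      finally show "(Q *\<^sub>v homogeneous_point k s t) $ i = (d \<cdot>\<^sub>v g j) $ i" using i gc[OF j] by simp
    qed (use Q gc[OF j] in simp)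
    moreover have "s \<noteq> 0 \<or> t \<noteq> 0" using eq[of 0] gnz[of 0] k by auto
    ultimately show ?thesis by blast
  qed
  \<comment> \<open>A vector in the kernel of the transpose is orthogonal to the range of
    \<open>Q\<close>, which contains a nonzero multiple of each unit vector by
    \<open>pts\<close>.\<close>
  have detQ: "det Q \<noteq> 0"
  proof
    assume "det Q = 0"
    hence "det (Q\<^sup>T) = 0" using det_transpose[OF Q] by simp
    then obtain y where y: "y \<in> carrier_vec k" "y \<noteq> 0\<^sub>v k" "Q\<^sup>T *\<^sub>v y = 0\<^sub>v k"
      using det_0_iff_vec_prod_zero_field[of "Q\<^sup>T" k] Q by auto
    have "y $ j = 0" if j: "j < k" for j
    proof -
      from pts[of j] j kn obtain s t d where d: "d \<noteq> 0" "Q *\<^sub>v homogeneous_point k s t = d \<cdot>\<^sub>v g j" by auto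
      have "(Q\<^sup>T *\<^sub>v y) \<bullet> homogeneous_point k s t = y \<bullet> (Q *\<^sub>v homogeneous_point k s t)"
        using transpose_vec_mult_scalar[OF Q hc y(1)] .
      hence "y \<bullet> (d \<cdot>\<^sub>v unit_vec k j) = 0" using y(3) d(2) unit[OF j] hc by simp
      thus ?thesis using d(1) y j by simp
    qed
    hence "y = 0\<^sub>v k" using y by (intro eq_vecI) auto
    thus False using y by simp
  qed
  obtain A where A: "A \<in> carrier_mat k k" "A * Q = 1\<^sub>m k" "det A \<noteq> 0"
    using invertible_mat_obtain[OF Q detQ] by metis
  have "\<exists>c P. c \<noteq> 0 \<and> A *\<^sub>v g j = c \<cdot>\<^sub>v nrc_point k P" if j: "j < ?n" for j
  proof -
    from pts[OF j] obtain s t d where d: "s \<noteq> 0 \<or> t \<noteq> 0" "d \<noteq> 0"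
      "Q *\<^sub>v homogeneous_point k s t = d \<cdot>\<^sub>v g j" by blast
    obtain c P where c: "c \<noteq> 0" "homogeneous_point k s t = c \<cdot>\<^sub>v nrc_point k P"
      using homogeneous_point_nrc[of k s t] k d(1) by auto
    have "d \<cdot>\<^sub>v (A *\<^sub>v g j) = A *\<^sub>v (d \<cdot>\<^sub>v g j)" using A(1) gc[OF j] by (simp add: mult_mat_vec[of _ k k])
    also have "\<dots> = (A * Q) *\<^sub>v homogeneous_point k s t"
      unfolding d(3)[symmetric] using A(1) Q hc by (simp add: assoc_mult_mat_vec[of _ k k _ k])
    also have "\<dots> = c \<cdot>\<^sub>v nrc_point k P" using A(2) c(2) hc by (metis one_mult_mat_vec)
    finally have eq: "d \<cdot>\<^sub>v (A *\<^sub>v g j) = c \<cdot>\<^sub>v nrc_point k P" .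
    have "A *\<^sub>v g j = (1 / d) \<cdot>\<^sub>v (d \<cdot>\<^sub>v (A *\<^sub>v g j))" using d(2) by (simp add: smult_smult_assoc)
    also have "\<dots> = (c / d) \<cdot>\<^sub>v nrc_point k P" unfolding eq by (simp add: smult_smult_assoc)
    finally show ?thesis using c(1) d(2) by (intro exI[of _ "c / d"] exI[of _ P]) auto
  qed
  then obtain c \<rho> where c\<rho>: "\<And>j. j < ?n \<Longrightarrow> c j \<noteq> 0 \<and> A *\<^sub>v g j = c j \<cdot>\<^sub>v nrc_point k (\<rho> j)" by metis
  have "inj_on \<rho> {..<?n}"
    by (rule projectively_injective[OF arc k(1) kn A(1,3), where v = "nrc_point k" and c = c])
      (use c\<rho> in auto)
  thus ?thesis unfolding nrc_equivalent_def using A c\<rho> by blast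
qed

section \<open>Duality\<close>

lemma CHAR_le_CARD: "CHAR('a::{field,finite}) \<le> CARD('a)"
proof -
  have "inj_on (of_nat :: nat \<Rightarrow> 'a) {..<CHAR('a)}"
  proof (rule linorder_inj_onI)
    fix m n assume mn: "m < n" "m \<in> {..<CHAR('a)}" "n \<in> {..<CHAR('a)}"
    hence "\<not> CHAR('a) dvd n - m" by (auto dest: dvd_imp_le)
    thus "of_nat m \<noteq> (of_nat n :: 'a)" using of_nat_eq_iff_char_dvd[OF mn(1), where 'a='a] by simp
  qed auto
  hence "card {..<CHAR('a)} \<le> card (UNIV :: 'a set)" by (rule card_inj_on_le) auto
  thus ?thesis by simp
qed

text \<open>The affine points contribute a power sum of exponent \<open>m + s \<le> q - 1\<close>.
  It is nonzero only for \<open>m = k - 1\<close> and \<open>s = k' - 1\<close>, where its value -1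
  is cancelled by the point at infinity.\<close>

lemma sum_nrc_point_orthogonal:
  assumes "m < k" "s < k'" "k + k' = CARD('a::{field,finite}) + 1"
  shows "(\<Sum>P\<in>UNIV. nrc_point k P $ m * nrc_point k' P $ s) = (0::'a)"
proof -
  have "(\<Sum>P\<in>(UNIV :: 'a option set). nrc_point k P $ m * nrc_point k' P $ s) =
      nrc_point k None $ m * nrc_point k' None $ s + (\<Sum>P\<in>range Some. nrc_point k P $ m * nrc_point k' P $ s)"
    by (subst UNIV_option_conv, subst sum.insert) auto
  also have "(\<Sum>P\<in>range Some. nrc_point k P $ m * nrc_point k' P $ s) = (\<Sum>t\<in>(UNIV::'a set). t ^ (m + s))"
    using assms by (subst sum.reindex) (auto simp: nrc_point_def power_add)
  also have "\<dots> = (if m + s = CARD('a) - 1 then -1 else 0)"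
    using assms by (intro finite_field_sum_power) auto
  finally show ?thesis using assms by (auto simp: nrc_point_def)
qed

text \<open>With \<open>G = (1 | X)\<close>, the dual code is spanned by the rows of \<open>(- X\<^sup>T | 1)\<close>.\<close>

lemma nrc_equivalent_dual:
  fixes g :: "nat \<Rightarrow> 'a::{field,finite} vec"
  assumes arc: "arc_on k (CARD('a) + 1) g" and unit: "\<And>j. j < k \<Longrightarrow> g j = unit_vec k j"
    and kk: "k + k' = CARD('a) + 1" and k1: "1 \<le> k"
    and dual: "\<And>h :: nat \<Rightarrow> 'a vec. arc_on k' (CARD('a) + 1) h \<Longrightarrow> nrc_equivalent k' (CARD('a) + 1) h"
  shows "nrc_equivalent k (CARD('a) + 1) g"
proof -
  let ?n = "CARD('a) + 1"
  have kn: "k \<le> ?n" using kk by simp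
  have gc: "g j \<in> carrier_vec k" if "j < ?n" for j using arc that by (simp add: arc_on_def)
  have "(\<Sum>j<a + b. f j) = (\<Sum>j<a. f j) + (\<Sum>r<b. f (a + r))" for f :: "nat \<Rightarrow> 'a" and a b
    by (induction b) (auto simp: add.assoc)
  hence split: "(\<Sum>j<?n. f j) = (\<Sum>j<k. f j) + (\<Sum>r<k'. f (k + r))" for f :: "nat \<Rightarrow> 'a"
    unfolding kk[symmetric] .
  define h where "h j = vec k' (\<lambda>r. if j < k then - g (k + r) $ j else if j = k + r then 1 else 0)" for j
  have hc: "h j \<in> carrier_vec k'" for j by (simp add: h_def)
  have harc: "arc_on k' ?n h"
    unfolding arc_on_def
  proof (intro conjI allI impI)
    fix js assume js: "distinct js \<and> length js = k' \<and> set js \<subseteq> {..<?n}"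
    show "det (mat_of_cols k' (map h js)) \<noteq> 0"
    proof
      assume "det (mat_of_cols k' (map h js)) = 0"
      then obtain y where y: "y \<in> carrier_vec k'" "y \<noteq> 0\<^sub>v k'" and zero: "\<And>j. j \<in> set js \<Longrightarrow> h j \<bullet> y = 0"
        using js hc by (subst (asm) det_mat_of_cols_zero_left) auto
      \<comment> \<open>A word of the dual code, that is, a linear relation between the points
        \<open>g j\<close>, as \<open>rel\<close> confirms.\<close>
      define c where "c j = h j \<bullet> y" for j
      have c: "c j = (\<Sum>r<k'. h j $ r * y $ r)" for j
        using y by (simp add: c_def scalar_prod_def atLeast0LessThan)
      have c1: "c j = - (\<Sum>r<k'. g (k + r) $ j * y $ r)" if "j < k" for j
        unfolding c sum_negf[symmetric] using that by (intro sum.cong) (auto simp: h_def)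
      have c2: "c (k + r) = y $ r" if r: "r < k'" for r
      proof -
        have "c (k + r) = (\<Sum>r'<k'. if r' = r then y $ r else 0)"
          unfolding c by (intro sum.cong) (auto simp: h_def)
        thus ?thesis using r by simp
      qed
      have rel: "(\<Sum>j<?n. c j * g j $ i) = 0" if i: "i < k" for i
      proof -
        have "(\<Sum>j<k. c j * g j $ i) = (\<Sum>j<k. if j = i then c i else 0)"
          using i unit by (intro sum.cong) auto
        hence "(\<Sum>j<k. c j * g j $ i) = c i" using i by simp
        moreover have "(\<Sum>r<k'. c (k + r) * g (k + r) $ i) = (\<Sum>r<k'. g (k + r) $ i * y $ r)"
          using c2 by (intro sum.cong) auto
        ultimately show ?thesis unfolding split using c1[OF i] by simp
      qed
      \<comment> \<open>The relation \<open>c\<close> vanishes on \<open>js\<close>, so it involves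
        only the remaining \<open>k\<close> points of the arc and must be trivial.\<close>
      let ?I = "{..<?n} - set js"
      have cI: "card ?I = k" using js kk by (subst card_Diff_subset) (auto simp: distinct_card)
      have "(\<Sum>j\<in>?I. c j * g j $ i) = 0" if i: "i < k" for i
      proof -
        have "(\<Sum>j<?n. c j * g j $ i) = (\<Sum>j\<in>?I. c j * g j $ i)"
          using zero by (intro sum.mono_neutral_right) (auto simp: c_def)
        thus ?thesis using rel[OF i] by simp
      qed
      hence "c j = 0" if "j \<in> ?I" for j
        using arc_on_independent[OF arc _ cI, of c j] that by blast
      hence "c j = 0" if "j < ?n" for j using zero[of j] that by (cases "j \<in> set js") (auto simp: c_def)
      hence "y $ r = 0" if "r < k'" for r using c2[OF that] that kk by simp
      thus False using y by (auto simp: vec_eq_iff)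
    qed
  qed (use hc in simp)
  from dual[OF harc] obtain A \<rho> c where A: "A \<in> carrier_mat k' k'" "det A \<noteq> 0"
    and inj: "inj_on \<rho> {..<?n}"
    and eq: "\<And>j. j < ?n \<Longrightarrow> c j \<noteq> 0 \<and> A *\<^sub>v h j = c j \<cdot>\<^sub>v nrc_point k' (\<rho> j)"
    unfolding nrc_equivalent_def by blast
  obtain B where B: "B \<in> carrier_mat k' k'" "B * A = 1\<^sub>m k'" using invertible_mat_obtain[OF A] by metis
  have "card (\<rho> ` {..<?n}) = CARD('a option)" using inj by (simp add: card_image card_UNIV_option)
  hence bij: "bij_betw \<rho> {..<?n} UNIV"
    using inj by (simp add: bij_betw_def card_subset_eq)
  \<comment> \<open>The curve in dimension \<open>k\<close> at the same parameters, with inverse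
    scalars so that the factors \<open>c j\<close> cancel in \<open>orth\<close>.\<close>
  define W where "W j = (1 / c j) \<cdot>\<^sub>v nrc_point k (\<rho> j)" for j
  have Wc: "W j \<in> carrier_vec k" for j by (simp add: W_def)
  have hB: "h j $ r = c j * (\<Sum>s<k'. B $$ (r, s) * nrc_point k' (\<rho> j) $ s)" if j: "j < ?n" and r: "r < k'" for j r
  proof -
    have "h j = B *\<^sub>v (A *\<^sub>v h j)" using A(1) B hc[of j] by (metis assoc_mult_mat_vec one_mult_mat_vec)
    also have "\<dots> = c j \<cdot>\<^sub>v (B *\<^sub>v nrc_point k' (\<rho> j))"
      using eq[OF j] B(1) by (simp add: mult_mat_vec[of _ k' k'])
    finally have "h j $ r = c j * (B *\<^sub>v nrc_point k' (\<rho> j)) $ r" using B(1) r by simp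
    also have "(B *\<^sub>v nrc_point k' (\<rho> j)) $ r = (\<Sum>s<k'. B $$ (r, s) * nrc_point k' (\<rho> j) $ s)"
      by (rule mult_vec_index[OF B(1) nrc_point_carrier r])
    finally show ?thesis .
  qed
  have orth: "(\<Sum>j<?n. W j $ m * h j $ r) = 0" if m: "m < k" and r: "r < k'" for m r
  proof -
    have "(\<Sum>j<?n. W j $ m * h j $ r) =
        (\<Sum>j<?n. \<Sum>s<k'. B $$ (r, s) * (nrc_point k (\<rho> j) $ m * nrc_point k' (\<rho> j) $ s))"
    proof (rule sum.cong[OF refl])
      fix j assume "j \<in> {..<?n}"
      hence j: "j < ?n" by simp
      have "W j $ m = (1 / c j) * nrc_point k (\<rho> j) $ m"
        unfolding W_def by (rule index_smult_vec(1)) (use m in simp)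
      hence "W j $ m * h j $ r = nrc_point k (\<rho> j) $ m * (\<Sum>s<k'. B $$ (r, s) * nrc_point k' (\<rho> j) $ s)"
        unfolding hB[OF j r] using eq[OF j] by simp
      thus "W j $ m * h j $ r = (\<Sum>s<k'. B $$ (r, s) * (nrc_point k (\<rho> j) $ m * nrc_point k' (\<rho> j) $ s))"
        by (simp add: sum_distrib_left mult_ac)
    qed
    also have "\<dots> = (\<Sum>s<k'. B $$ (r, s) * (\<Sum>j<?n. nrc_point k (\<rho> j) $ m * nrc_point k' (\<rho> j) $ s))"
      unfolding sum_distrib_left by (rule sum.swap)
    also have "\<dots> = (\<Sum>s<k'. B $$ (r, s) * (\<Sum>P\<in>UNIV. nrc_point k P $ m * nrc_point k' P $ s))"
      using sum.reindex_bij_betw[OF bij, of "\<lambda>P. nrc_point k P $ m * nrc_point k' P $ _"] by simp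
    also have "\<dots> = 0" using sum_nrc_point_orthogonal[OF m _ kk] by simp
    finally show ?thesis .
  qed
  \<comment> \<open>Orthogonality to row \<open>r\<close> of the dual matrix expresses
    \<open>W (k + r)\<close> through the first \<open>k\<close> vectors \<open>W j\<close>, with the
    coordinates of \<open>g (k + r)\<close> as coefficients. Hence the matrix with these
    \<open>k\<close> columns maps \<open>g\<close> to \<open>W\<close>.\<close>
  have Wrel: "W (k + r) $ m = (\<Sum>j<k. W j $ m * g (k + r) $ j)" if m: "m < k" and r: "r < k'" for m r
  proof -
    have "(\<Sum>r'<k'. W (k + r') $ m * h (k + r') $ r) = (\<Sum>r'<k'. if r' = r then W (k + r) $ m else 0)"
      using r by (intro sum.cong) (auto simp: h_def)
    hence "(\<Sum>r'<k'. W (k + r') $ m * h (k + r') $ r) = W (k + r) $ m" using r by simp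
    moreover have "(\<Sum>j<k. W j $ m * h j $ r) = - (\<Sum>j<k. W j $ m * g (k + r) $ j)"
      unfolding sum_negf[symmetric] using r by (intro sum.cong) (auto simp: h_def)
    ultimately show ?thesis using orth[OF m r] unfolding split by simp
  qed
  let ?A = "mat_of_cols k (map W [0..<k])"
  have A': "?A \<in> carrier_mat k k" using mat_of_cols_carrier(1)[of k "map W [0..<k]"] by simp
  have "?A *\<^sub>v g x = W x" if x: "x < ?n" for x
  proof (rule eq_vecI)
    fix m assume "m < dim_vec (W x)"
    hence m: "m < k" using Wc[of x] by simp
    have "(?A *\<^sub>v g x) $ m = (\<Sum>j<k. ?A $$ (m, j) * g x $ j)"
      by (rule mult_vec_index[OF A' gc[OF x] m])
    also have "\<dots> = (\<Sum>j<k. W j $ m * g x $ j)"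
      using m by (intro sum.cong) (auto simp: mat_of_cols_index)
    also have "\<dots> = W x $ m"
    proof (cases "x < k")
      case True
      have "(\<Sum>j<k. W j $ m * g x $ j) = (\<Sum>j<k. if j = x then W x $ m else 0)"
        using unit[OF True] True by (intro sum.cong) auto
      thus ?thesis using True by simp
    next
      case False
      then obtain r where "x = k + r" "r < k'" using x kk by (metis add_less_cancel_left le_add_diff_inverse not_le)
      thus ?thesis using Wrel[OF m] by simp
    qed
    finally show "(?A *\<^sub>v g x) $ m = W x $ m" .
  qed (use Wc[of x] in simp)
  \<comment> \<open>The columns are nonzero multiples of curve points at \<open>k\<close> distinct
    parameters.\<close>
  moreover have "det ?A \<noteq> 0"
  proof
    assume "det ?A = 0"
    then obtain y where y: "y \<in> carrier_vec k" "y \<noteq> 0\<^sub>v k" and zero: "\<And>j. j < k \<Longrightarrow> W j \<bullet> y = 0"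
      using Wc by (subst (asm) det_mat_of_cols_zero_left) auto
    have "y = 0\<^sub>v k"
    proof (rule arc_on_annihilator[OF arc_on_nrc_point[OF inj k1], of "{..<k}"])
      fix j assume "j \<in> {..<k}"
      hence j: "j < k" "j < ?n" using kn by auto
      have "W j \<bullet> y = (1 / c j) * (nrc_point k (\<rho> j) \<bullet> y)"
        unfolding W_def using y by (intro smult_scalar_prod_distrib[of _ k]) auto
      thus "nrc_point k (\<rho> j) \<bullet> y = 0" using zero[OF j(1)] eq[OF j(2)] by simp
    qed (use y kn in auto)
    thus False using y by simp
  qed
  ultimately show ?thesis unfolding nrc_equivalent_def using inj eq A'
    by (intro exI[of _ ?A] exI[of _ \<rho>] exI[of _ "\<lambda>j. 1 / c j"]) (auto simp: W_def)
qed

text \<open>In dimension 1 every curve point is the vector 1, so any bijection of the indices with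
  the projective line serves. This also covers the dual dimension 1 of \<open>k = q\<close>.\<close>

lemma nrc_equivalent_one:
  fixes g :: "nat \<Rightarrow> 'a::{field,finite} vec"
  assumes arc: "arc_on 1 (CARD('a) + 1) g"
  shows "nrc_equivalent 1 (CARD('a) + 1) g"
proof -
  let ?n = "CARD('a) + 1"
  have "CARD('a option) = ?n" by (simp add: card_UNIV_option)
  then obtain \<rho> :: "nat \<Rightarrow> 'a option" where "bij_betw \<rho> {0..<?n} UNIV"
    using ex_bij_betw_nat_finite[of "UNIV :: 'a option set"] by auto
  hence inj: "inj_on \<rho> {..<?n}" by (simp add: bij_betw_def atLeast0LessThan)
  have "g j $ 0 \<noteq> 0 \<and> 1\<^sub>m 1 *\<^sub>v g j = g j $ 0 \<cdot>\<^sub>v nrc_point 1 (\<rho> j)" if j: "j < ?n" for j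
  proof
    have gj: "g j \<in> carrier_vec 1" using arc j by (simp add: arc_on_def)
    have "det (mat_of_cols 1 (map g [j])) \<noteq> 0"
      using arc j unfolding arc_on_def by (elim conjE allE[of _ "[j]"]) auto
    thus "g j $ 0 \<noteq> 0"
      by (subst (asm) det_single) (auto simp: mat_of_cols_def)
    show "1\<^sub>m 1 *\<^sub>v g j = g j $ 0 \<cdot>\<^sub>v nrc_point 1 (\<rho> j)"
      using gj by (cases "\<rho> j") (auto simp: nrc_point_def intro!: eq_vecI)
  qed
  thus ?thesis unfolding nrc_equivalent_def using inj
    by (intro exI[of _ "1\<^sub>m 1"] exI[of _ \<rho>] exI[of _ "\<lambda>j. g j $ 0"]) auto
qed

section \<open>Classification of arcs of size \<open>q + 1\<close>\<close>

lemma arc_nrc_equivalent: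
  fixes g :: "nat \<Rightarrow> 'a::{field,finite} vec"
  assumes k: "1 \<le> k" "k \<le> CHAR('a)" and ne: "2 * k \<noteq> CARD('a) + 1"
    and arc: "arc_on k (CARD('a) + 1) g"
  shows "nrc_equivalent k (CARD('a) + 1) g"
proof -
  let ?n = "CARD('a) + 1"
  \<comment> \<open>Stated for arbitrary \<open>k\<close> and \<open>g\<close>, because the dual
    case applies it in dimension \<open>k'\<close>.\<close>
  have small: "nrc_equivalent k ?n g"
    if k: "1 \<le> k" "k \<le> CHAR('a)" "2 * k \<le> CARD('a)" and arc: "arc_on k ?n g" for k and g :: "nat \<Rightarrow> 'a vec"
  proof (cases "k = 1")
    case True thus ?thesis using nrc_equivalent_one arc by simp
  next
    case False
    have kn: "k \<le> ?n" using k by simp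
    obtain M where M: "M \<in> carrier_mat k k" "det M \<noteq> 0" "\<And>j. j < k \<Longrightarrow> M *\<^sub>v g j = unit_vec k j"
      by (rule arc_on_normalise[OF arc kn]) (rule that)
    have "nrc_equivalent k ?n (\<lambda>j. M *\<^sub>v g j)"
      using k False M(3) by (intro nrc_equivalent_normalised arc_on_mult[OF arc M(1,2)]) auto
    thus ?thesis by (rule nrc_equivalent_mult[OF _ M(1,2), rotated]) (use arc in \<open>simp add: arc_on_def\<close>)
  qed
  show ?thesis
  proof (cases "2 * k \<le> CARD('a)")
    case True thus ?thesis using small k arc by blast
  next
    case False
    have kq: "k \<le> CARD('a)" using k CHAR_le_CARD[where 'a='a] by simp
    hence kn: "k \<le> ?n" by simp
    obtain M where M: "M \<in> carrier_mat k k" "det M \<noteq> 0" "\<And>j. j < k \<Longrightarrow> M *\<^sub>v g j = unit_vec k j"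
      by (rule arc_on_normalise[OF arc kn]) (rule that)
    \<comment> \<open>Since \<open>2 * k\<close> exceeds \<open>q\<close> and differs from
      \<open>q + 1\<close>, it is at least \<open>q + 2\<close>. So \<open>2 * k' \<le> q\<close>
      and \<open>k' < k \<le> CHAR('a)\<close>, as \<open>small\<close> requires.\<close>
    define k' where "k' = ?n - k"
    have k': "1 \<le> k'" "k' \<le> CHAR('a)" "2 * k' \<le> CARD('a)" "k + k' = ?n"
      using kq False ne k by (auto simp: k'_def)
    have "nrc_equivalent k ?n (\<lambda>j. M *\<^sub>v g j)"
      by (rule nrc_equivalent_dual[OF arc_on_mult[OF arc M(1,2)] M(3) k'(4) k(1)])
        (use small k'(1-3) in auto)
    thus ?thesis by (rule nrc_equivalent_mult[OF _ M(1,2), rotated]) (use arc in \<open>simp add: arc_on_def\<close>)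
  qed
qed

text \<open>As points may coincide for \<open>k = 1\<close>, the parameters are not read off from
  the entries of \<open>R\<close>. They come from permuting an enumeration of the projective line
  along the equality of multisets.\<close>

lemma normal_rational_curve_list:
  fixes R :: "'a::{field,finite} vec list"
  assumes R: "mset R = normal_rational_curve k"
  obtains \<pi> where "bij_betw \<pi> {..<CARD('a) + 1} UNIV" "length R = CARD('a) + 1"
    "\<And>j. j < CARD('a) + 1 \<Longrightarrow> R ! j = nrc_point k (\<pi> j)"
proof -
  obtain xs :: "'a option list" where xs: "mset xs = mset_set UNIV" using ex_mset by blast
  have "(mset_set UNIV :: 'a option multiset) = mset_set (insert None (range Some))"
    by (simp add: UNIV_option_conv)
  also have "\<dots> = add_mset None (image_mset Some (mset_set UNIV))"
    by (subst mset_set.insert) (auto simp: image_mset_mset_set)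
  finally have U: "(mset_set UNIV :: 'a option multiset) = add_mset None (image_mset Some (mset_set UNIV))" .
  have "mset (map (nrc_point k) xs) = image_mset (nrc_point k) (mset_set UNIV)" using xs by simp
  also have "\<dots> = normal_rational_curve k"
    unfolding U normal_rational_curve_def by (simp add: nrc_point_def multiset.map_comp comp_def)
  finally have "mset R = mset (map (nrc_point k) xs)" using R by simp
  then obtain p where p: "p permutes {..<length (map (nrc_point k) xs)}"
    "permute_list p (map (nrc_point k) xs) = R" by (rule mset_eq_permutation)
  have p': "p permutes {..<length xs}" using p(1) by simp
  define zs where "zs = permute_list p xs"
  have Rz: "R = map (nrc_point k) zs" using p(2)[symmetric] permute_list_map[OF p', of "nrc_point k"] by (simp add: zs_def)
  have zs: "mset zs = mset_set UNIV" using p' xs by (simp add: zs_def)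
  have sz: "set zs = UNIV" using zs by (metis finite finite_set_mset_mset_set set_mset_mset)
  have lz: "length zs = CARD('a) + 1"
    using arg_cong[OF zs, of size] by (simp add: card_UNIV_option)
  have dz: "distinct zs" using sz lz by (intro card_distinct) (simp add: card_UNIV_option)
  have "bij_betw ((!) zs) {..<CARD('a) + 1} UNIV" using dz lz sz by (intro bij_betw_nth) auto
  thus ?thesis using lz by (intro that[of "(!) zs"]) (auto simp: Rz)
qed

section \<open>Colexicographic order and the column space\<close>

lemma colex_subsets_props:
  shows "sorted_wrt colex_less (colex_subsets n r)" "set (colex_subsets n r) = {A. A \<subseteq> {..<n} \<and> card A = r}"
    "distinct (colex_subsets n r)" "length (colex_subsets n r) = n choose r"
proof -
  have *: "sorted_wrt colex_less (colex_subsets n r) \<and> set (colex_subsets n r) = {A. A \<subseteq> {..<n} \<and> card A = r}"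
    unfolding colex_subsets_def by (rule theI'[OF colex_subsets_ex1])
  thus s: "sorted_wrt colex_less (colex_subsets n r)" "set (colex_subsets n r) = {A. A \<subseteq> {..<n} \<and> card A = r}"
    by auto
  show d: "distinct (colex_subsets n r)"
    unfolding distinct_conv_nth
  proof (intro allI impI)
    fix i j assume ij: "i < length (colex_subsets n r)" "j < length (colex_subsets n r)" "i \<noteq> j"
    hence "colex_less (colex_subsets n r ! i) (colex_subsets n r ! j) \<or> colex_less (colex_subsets n r ! j) (colex_subsets n r ! i)"
      using sorted_wrt_nth_less[OF s(1), of i j] sorted_wrt_nth_less[OF s(1), of j i]
      by (cases i j rule: linorder_cases) auto
    thus "colex_subsets n r ! i \<noteq> colex_subsets n r ! j" by (auto simp: colex_less_def)
  qed
  have "length (colex_subsets n r) = card {A. A \<subseteq> {..<n} \<and> card A = r}"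
    using distinct_card[OF d] s(2) by simp
  thus "length (colex_subsets n r) = n choose r" by (simp add: n_subsets)
qed

text \<open>The largest element of the symmetric difference lies in \<open>C\<close>, hence below
  \<open>k\<close>, and it bounds every element of \<open>D\<close> outside
  \<open>C\<close>.\<close>

lemma colex_less_subset_lessThan:
  assumes "colex_less D C" "C \<subseteq> {..<k}" "finite D"
  shows "D \<subseteq> {..<k}"
proof
  fix d assume d: "d \<in> D"
  show "d \<in> {..<k}"
  proof (rule ccontr)
    assume "d \<notin> {..<k}"
    hence dk: "d \<ge> k" "d \<in> sym_diff D C" using d assms(2) by auto
    have "finite (sym_diff D C)" using assms(2,3) finite_subset by auto
    hence "d \<le> Max (sym_diff D C)" using dk(2) by (rule Max_ge)
    moreover have "Max (sym_diff D C) < k" using assms(1,2) by (auto simp: colex_less_def)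
    ultimately show False using dk by simp
  qed
qed

lemma downclosed_nat_set:
  fixes X :: "nat set"
  assumes fin: "finite X" and down: "\<And>i j. j \<in> X \<Longrightarrow> i < j \<Longrightarrow> i \<in> X"
  shows "X = {..<card X}"
proof (rule card_subset_eq[symmetric])
  show "{..<card X} \<subseteq> X"
  proof
    fix i assume i: "i \<in> {..<card X}"
    show "i \<in> X"
    proof (rule ccontr)
      assume "i \<notin> X"
      hence "X \<subseteq> {..<i}" using down by (metis lessThan_iff linorder_neqE_nat subsetI)
      hence "card X \<le> card {..<i}" by (intro card_mono) auto
      thus False using i by simp
    qed
  qed
qed (use fin in auto)

text \<open>The \<open>(k - 1)\<close>-subsets of \<open>{..<k}\<close> are closed under colex
  predecessors and there are \<open>k\<close> of them, so they occupy exactly the first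
  \<open>k\<close> rows.\<close>

lemma colex_initial_segment:
  assumes k: "1 \<le> k" "k \<le> n" and i: "i < n choose (k - 1)"
  shows "colex_subsets n (k - 1) ! i \<subseteq> {..<k} \<longleftrightarrow> i < k"
proof -
  let ?C = "colex_subsets n (k - 1)"
  note P = colex_subsets_props[where n = n and r = "k - 1"]
  define X where "X = {i. i < length ?C \<and> ?C ! i \<subseteq> {..<k}}"
  have fin: "finite (?C ! j)" if "j < length ?C" for j
    using nth_mem[OF that] P(2) finite_subset[of _ "{..<n}"] by auto
  have "X = {..<card X}"
  proof (rule downclosed_nat_set)
    fix i j assume j: "j \<in> X" "i < j"
    hence "colex_less (?C ! i) (?C ! j)" "i < length ?C"
      using sorted_wrt_nth_less[OF P(1), of i j] by (auto simp: X_def)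
    thus "i \<in> X" using j(1) colex_less_subset_lessThan fin by (auto simp: X_def)
  qed (simp add: X_def)
  moreover have "card X = k"
  proof -
    have "card X = card ((!) ?C ` X)"
      by (rule card_image[symmetric]) (use P(3) in \<open>auto simp: X_def inj_on_def nth_eq_iff_index_eq\<close>)
    also have "(!) ?C ` X = {A. A \<subseteq> {..<k} \<and> card A = k - 1}"
    proof (intro equalityI subsetI)
      fix A assume "A \<in> {A. A \<subseteq> {..<k} \<and> card A = k - 1}"
      hence A: "A \<subseteq> {..<k}" "A \<in> set ?C" using k unfolding P(2) by auto
      then obtain j where "j < length ?C" "A = ?C ! j" by (metis in_set_conv_nth)
      thus "A \<in> (!) ?C ` X" using A by (auto simp: X_def)
    next
      fix A assume "A \<in> (!) ?C ` X"
      then obtain j where j: "j < length ?C" "A = ?C ! j" "A \<subseteq> {..<k}" by (auto simp: X_def)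
      hence "A \<in> set ?C" by simp
      thus "A \<in> {A. A \<subseteq> {..<k} \<and> card A = k - 1}" using j unfolding P(2) by auto
    qed
    also have "card \<dots> = k" using n_subsets[of "{..<k}" "k - 1"] k binomial_symmetric[of 1 k] by simp
    finally show ?thesis .
  qed
  ultimately show ?thesis using i P(4) by (auto simp: X_def)
qed

text \<open>The coefficient of column \<open>A\<close> is its weight with respect to
  \<open>K = {..<k}\<close>. The \<open>(k - 2)\<close>-subsets of a row \<open>C\<close> are the
  sets \<open>C - {c}\<close>, so \<open>sum_inclusion_weight\<close> evaluates the product and
  \<open>colex_initial_segment\<close> locates its ones.\<close>

lemma indicator_in_col_space:
  fixes G :: "'a::field vec list"
  assumes k: "2 \<le> k" "k \<le> CHAR('a)" and G: "length G = 2 * k - 2"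
  shows "vec ((2 * k - 2) choose (k - 1)) (\<lambda>i. if i < k then 1 else 0)
    \<in> vec_space.col_space ((2 * k - 2) choose (k - 1)) (inclusion_matrix k G)"
proof -
  let ?n = "2 * k - 2"
  let ?N = "?n choose (k - 1)" and ?Cs = "colex_subsets ?n (k - 1)" and ?As = "colex_subsets ?n (k - 2)"
  let ?H = "inclusion_matrix k G"
  interpret vec_space "TYPE('a)" ?N .
  note C = colex_subsets_props[where n = ?n and r = "k - 1"]
  note A = colex_subsets_props[where n = ?n and r = "k - 2"]
  have H: "?H = mat ?N (length ?As) (\<lambda>(i, j). if ?As ! j \<subseteq> ?Cs ! i then 1 else 0)"
    unfolding inclusion_matrix_def Let_def G C(4) ..
  have Hc: "?H \<in> carrier_mat ?N (length ?As)" by (simp add: H)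
  define w where "w A = (inclusion_weight k (card (A \<inter> {..<k})) :: 'a)" for A
  define x where "x = vec (length ?As) (\<lambda>j. w (?As ! j))"
  have x: "x \<in> carrier_vec (length ?As)" by (simp add: x_def)
  have "?H *\<^sub>v x = vec ?N (\<lambda>i. if i < k then 1 else 0)"
  proof (rule eq_vecI)
    fix i assume "i < dim_vec (vec ?N (\<lambda>i. if i < k then 1 else 0 :: 'a))"
    hence i: "i < ?N" by simp
    let ?C = "?Cs ! i"
    have "?C \<in> set ?Cs" using i C(4) by simp
    hence Ci: "?C \<subseteq> {..<?n}" "card ?C = k - 1" unfolding C(2) by auto
    have fin: "finite ?C" using Ci finite_subset by blast
    have bij: "bij_betw ((!) ?As) {..<length ?As} (set ?As)" using A(3) by (intro bij_betw_nth) auto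
    have "(?H *\<^sub>v x) $ i = (\<Sum>j<length ?As. ?H $$ (i, j) * x $ j)" by (rule mult_vec_index[OF Hc x i])
    also have "\<dots> = (\<Sum>j<length ?As. if ?As ! j \<subseteq> ?C then w (?As ! j) else 0)"
      using i by (intro sum.cong) (auto simp: H x_def)
    also have "\<dots> = (\<Sum>A\<in>set ?As. if A \<subseteq> ?C then w A else 0)"
      by (rule sum.reindex_bij_betw[OF bij])
    also have "\<dots> = (\<Sum>A\<in>{A \<in> set ?As. A \<subseteq> ?C}. w A)" by (simp add: sum.inter_filter)
    also have "\<dots> = (\<Sum>c\<in>?C. w (?C - {c}))"
    proof (rule sum.reindex_bij_betw[symmetric])
      show "bij_betw (\<lambda>c. ?C - {c}) ?C {A \<in> set ?As. A \<subseteq> ?C}"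
        unfolding bij_betw_def
      proof
        show "inj_on (\<lambda>c. ?C - {c}) ?C" by (auto intro!: inj_onI)
        show "(\<lambda>c. ?C - {c}) ` ?C = {A \<in> set ?As. A \<subseteq> ?C}"
        proof (intro equalityI subsetI)
          fix B assume "B \<in> {A \<in> set ?As. A \<subseteq> ?C}"
          hence B: "B \<subseteq> ?C" "card B = k - 2" unfolding A(2) by auto
          hence "card (?C - B) = 1" using Ci fin k by (subst card_Diff_subset) (auto intro: finite_subset)
          then obtain c where "?C - B = {c}" by (auto simp: card_1_singleton_iff)
          hence "B = ?C - {c}" "c \<in> ?C" using B by auto
          thus "B \<in> (\<lambda>c. ?C - {c}) ` ?C" by blast
        next
          fix B assume "B \<in> (\<lambda>c. ?C - {c}) ` ?C"
          thus "B \<in> {A \<in> set ?As. A \<subseteq> ?C}" using Ci fin unfolding A(2) by (auto simp: numeral_2_eq_2)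
        qed
      qed
    qed
    also have "\<dots> = (if ?C \<subseteq> {..<k} then 1 else 0)"
      unfolding w_def
    proof (rule sum_inclusion_weight[OF k fin Ci(2)])
      show "?C \<inter> {..<k} \<noteq> {}"
      proof
        assume disj: "?C \<inter> {..<k} = {}"
        \<comment> \<open>Only \<open>k - 2\<close> positions lie beyond the first \<open>k\<close>,
          too few for a set of size \<open>k - 1\<close>.\<close>
        have "?C \<subseteq> {k..<?n}"
        proof
          fix x assume "x \<in> ?C"
          hence "x \<notin> {..<k}" "x \<in> {..<?n}" using disj Ci(1) by blast+
          thus "x \<in> {k..<?n}" by simp
        qed
        hence "card ?C \<le> card {k..<?n}" by (intro card_mono) auto
        thus False using Ci k by simp
      qed
    qed
    also have "(?C \<subseteq> {..<k}) = (i < k)" using k i by (intro colex_initial_segment) auto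
    finally show "(?H *\<^sub>v x) $ i = vec ?N (\<lambda>i. if i < k then 1 else 0) $ i" using i by simp
  qed (use Hc in simp)
  thus ?thesis using col_space_eq[OF Hc] Hc x by auto
qed

theorem theorem1p13:
  fixes k :: nat
  assumes "k \<ge> 1" and "k \<le> CHAR('a::{field,finite})"
  shows "(\<forall>G :: 'a vec list. arc k G \<and> length G = 2 * k - 2 \<longrightarrow>
            vec ((2 * k - 2) choose (k - 1)) (\<lambda>i. if i < k then 1 else 0)
              \<in> vec_space.col_space ((2 * k - 2) choose (k - 1)) (inclusion_matrix k G)) \<and>
         (real k \<noteq> (real CARD('a) + 1) / 2 \<longrightarrow>
            (\<forall>R :: 'a vec list. mset R = normal_rational_curve k \<longrightarrow>
               arc k R \<and> length R = CARD('a) + 1 \<and>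
               (\<forall>G :: 'a vec list. arc k G \<and> length G = CARD('a) + 1 \<longrightarrow>
                  linearly_equivalent k G R)))"
proof (intro conjI allI impI)
  fix G :: "'a vec list"
  assume G: "arc k G \<and> length G = 2 * k - 2"
  \<comment> \<open>For \<open>k = 1\<close> the length would be 0, but an arc has at least
    \<open>k\<close> vectors.\<close>
  hence "k \<ge> 2" using assms by (auto simp: arc_def)
  thus "vec ((2 * k - 2) choose (k - 1)) (\<lambda>i. if i < k then 1 else 0)
      \<in> vec_space.col_space ((2 * k - 2) choose (k - 1)) (inclusion_matrix k G)"
    using G assms by (intro indicator_in_col_space) auto
next
  let ?n = "CARD('a) + 1"
  fix R :: "'a vec list"
  assume "real k \<noteq> (real CARD('a) + 1) / 2"
  hence "2 * real k \<noteq> real CARD('a) + 1" by simp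
  hence ne: "2 * k \<noteq> ?n" by (metis of_nat_1 of_nat_add of_nat_mult of_nat_numeral)
  assume R: "mset R = normal_rational_curve k"
  obtain \<pi> :: "nat \<Rightarrow> 'a option" where \<pi>: "bij_betw \<pi> {..<?n} UNIV" and lenR: "length R = ?n"
    and R\<pi>: "\<And>j. j < ?n \<Longrightarrow> R ! j = nrc_point k (\<pi> j)"
    by (rule normal_rational_curve_list[OF R]) (rule that)
  show "length R = ?n" by (rule lenR)
  have nrc: "arc_on k ?n (\<lambda>j. nrc_point k (\<pi> j))"
    using \<pi> assms(1) by (intro arc_on_nrc_point) (auto simp: bij_betw_def)
  have "arc_on k ?n ((!) R)"
    unfolding arc_on_def
  proof (intro conjI allI impI)
    fix js assume js: "distinct js \<and> length js = k \<and> set js \<subseteq> {..<?n}"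
    have "det (mat_of_cols k (map (\<lambda>j. nrc_point k (\<pi> j)) js)) \<noteq> 0"
      using nrc js unfolding arc_on_def by blast
    moreover have "map ((!) R) js = map (\<lambda>j. nrc_point k (\<pi> j)) js"
      using js R\<pi> by (intro map_cong) auto
    ultimately show "det (mat_of_cols k (map ((!) R) js)) \<noteq> 0" by (simp only: not_False_eq_True)
  qed (simp add: R\<pi>)
  moreover have "k \<le> ?n" using assms CHAR_le_CARD[where 'a='a] by simp
  ultimately show "arc k R" using lenR by (simp add: arc_iff_arc_on)
  fix G :: "'a vec list"
  assume G: "arc k G \<and> length G = ?n"
  hence "arc_on k ?n ((!) G)" using arc_iff_arc_on by metis
  hence "nrc_equivalent k ?n ((!) G)" by (rule arc_nrc_equivalent[OF assms ne])
  then obtain A \<rho> c where A: "A \<in> carrier_mat k k" "det A \<noteq> 0" and inj: "inj_on \<rho> {..<?n}"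
    and eq: "\<And>j. j < ?n \<Longrightarrow> c j \<noteq> 0 \<and> A *\<^sub>v (G ! j) = c j \<cdot>\<^sub>v nrc_point k (\<rho> j)"
    unfolding nrc_equivalent_def by blast
  have "card (\<rho> ` {..<?n}) = CARD('a option)" using inj by (simp add: card_image card_UNIV_option)
  hence \<rho>: "bij_betw \<rho> {..<?n} UNIV" using inj by (simp add: bij_betw_def card_subset_eq)
  \<comment> \<open>Position \<open>\<sigma> j\<close> of \<open>G\<close> carries the same curve
    parameter as position \<open>j\<close> of \<open>R\<close>. Outside the index range
    \<open>permutes\<close> demands the identity.\<close>
  define \<sigma> where "\<sigma> j = (if j < ?n then the_inv_into {..<?n} \<rho> (\<pi> j) else j)" for j
  have inv: "bij_betw (the_inv_into {..<?n} \<rho>) UNIV {..<?n}" by (rule bij_betw_the_inv_into[OF \<rho>])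
  have "bij_betw (the_inv_into {..<?n} \<rho> \<circ> \<pi>) {..<?n} {..<?n}" by (rule bij_betw_trans[OF \<pi> inv])
  hence "bij_betw \<sigma> {..<?n} {..<?n}"
    by (rule bij_betw_cong[THEN iffD1, rotated]) (auto simp: \<sigma>_def)
  hence perm: "\<sigma> permutes {..<?n}" by (rule bij_imp_permutes) (auto simp: \<sigma>_def)
  have \<sigma>n: "\<sigma> j < ?n" if "j < ?n" for j using permutes_in_image[OF perm, of j] that by simp
  have \<rho>\<sigma>: "\<rho> (\<sigma> j) = \<pi> j" if "j < ?n" for j
    using that \<rho> by (simp add: \<sigma>_def f_the_inv_into_f bij_betw_def)
  show "linearly_equivalent k G R"
  proof (rule linearly_equivalentI[OF _ _ _ lenR A perm, where c = "\<lambda>j. 1 / c (\<sigma> j)"])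
    show "set R \<subseteq> carrier_vec k" using \<open>arc k R\<close> by (simp add: arc_def)
    fix j assume j: "j < ?n"
    show "1 / c (\<sigma> j) \<noteq> 0" using eq[OF \<sigma>n[OF j]] by simp
    have "1 / c (\<sigma> j) \<cdot>\<^sub>v (A *\<^sub>v (G ! \<sigma> j)) = nrc_point k (\<pi> j)"
      using eq[OF \<sigma>n[OF j]] \<rho>\<sigma>[OF j] by (simp add: smult_smult_assoc)
    thus "R ! j = 1 / c (\<sigma> j) \<cdot>\<^sub>v (A *\<^sub>v (G ! \<sigma> j))" using R\<pi>[OF j] by simp
  qed (use G in \<open>auto simp: arc_def\<close>)
qed

end
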